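(* Let $\mathcal A\subseteq B(\mathcal H)$, the unit vector $\xi$, the vector state $\varphi$, the Boolean independent $*$-subalgebras $(\mathcal A_i)_{i\in I}$ with $P_0\in\mathcal A_i$ for all $i$, the algebra $\hat{\mathcal A}$ and the projection $\hat P$ be as described in the context. Then the functional $\omega(X)=\operatorname{Tr}(\hat P X\hat P)$ is a semifinite trace on the algebra $\hat{\mathcal A}$, and the subalgebras $\mathcal A_i\cap T(\mathcal H)$, $i\in I$, are cyclic-Boolean independent with respect to $(\varphi,\omega)$.
   Context: Setting: $\mathcal H$ is a Hilbert space, $\mathcal A$ is a $*$-subalgebra of $B(\mathcal H)$, $\xi\in\mathcal H$ is a unit vector, and $\varphi(X)=\langle X\xi,\xi\rangle$. $P_0$ is the orthogonal projection onto $\mathbb C\xi$. $(\mathcal A_i)_{i\in I}$ is a family of $*$-subalgebras of $\mathcal A$ which are Boolean independent with respect to $\varphi$, i.e. $\varphi(X_1\cdots X_n)=\varphi(X_1)\cdots\varphi(X_n)$ whenever $n\ge2$, $X_j\in\mathcal A_{i_j}$ and $i_j\neq i_{j+1}$ for $1\le j<n$; it is assumed that $P_0\in\mathcal A_i$ for every $i$ (adjoining $P_0$ to each $\mathcal A_i$ and to $\mathcal A$ preserves Boolean independence). $\hat{\mathcal A}$ is the subalgebra of $\mathcal A$ generated by all the $\mathcal A_i$, $\hat{\mathcal H}=\overline{\hat{\mathcal A}\xi}$, and $\hat P$ is the orthogonal projection of $\mathcal H$ onto $\hat{\mathcal H}$. $T(\mathcal H)$ denotes the trace-class operators on $\mathcal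 H$ and $\operatorname{Tr}$ the usual trace. A trace on $\hat{\mathcal A}$ is understood in the usual sense of a possibly infinite trace: additive, positively homogeneous and $[0,\infty]$-valued on positive operators in $\hat{\mathcal A}$, with $\omega(X^*X)=\omega(XX^* )$; semifinite means that each nonzero positive element of $\hat{\mathcal A}$ dominates a nonzero positive element of $\hat{\mathcal A}$ with finite trace. A family of $*$-subalgebras $\{\mathcal B_k\}_{k\in K}$ is cyclic-Boolean independent with respect to $(\varphi,\omega)$ if: (i) it is Boolean independent with respect to $\varphi$, i.e. $\varphi(X_1\cdots X_n)=\varphi(X_1)\cdots\varphi(X_n)$ whenever $n\ge2$, $X_j\in\mathcal B_{k_j}$ and $k_j\neq k_{j+1}$ for $1\le j<n$; (ii) for any $n\ge2$, any cyclically alternating tuple $(k_1,\dots,k_n)$ (i.e. $k_1\ne k_2\ne\cdots\ne k_n\ne k_1$) and $X_j\in\mathcal B_{k_j}$, one has $\omega(X_1\cdots X_n)=\varphi(X_1)\cdots\varphi(X_n)$ (for $n=1$ the value is just $\omega(X_1)$). *)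

theory Defs
  imports "HOL-Analysis.Analysis"
begin

text \<open>Complex Hilbert spaces. The complex structure is put on top of the library's complete
  real inner product spaces, the real inner product being the real part of the complex one; so
  norm and topology are the library's. \<open>cinner\<close> is linear in its first argument.\<close>

class complex_hilbert_space = real_inner + complete_space +
  fixes scaleC :: "complex \<Rightarrow> 'a \<Rightarrow> 'a" (infixr "*\<^sub>C" 75)
    and cinner :: "'a \<Rightarrow> 'a \<Rightarrow> complex"
  assumes scaleC_add_right: "c *\<^sub>C (x + y) = c *\<^sub>C x + c *\<^sub>C y"
    and scaleC_add_left: "(c + d) *\<^sub>C x = c *\<^sub>C x + d *\<^sub>C x"
    and scaleC_scaleC: "c *\<^sub>C d *\<^sub>C x = (c * d) *\<^sub>C x"
    and scaleR_scaleC: "r *\<^sub>R x = complex_of_real r *\<^sub>C x"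
    and cinner_add_left: "cinner (x + y) z = cinner x z + cinner y z"
    and cinner_scaleC_left: "cinner (c *\<^sub>C x) y = c * cinner x y"
    and cinner_commute: "cinner x y = cnj (cinner y x)"
    and inner_eq_Re_cinner: "inner x y = Re (cinner x y)"

global_interpretation complex_vector:
  vector_space "scaleC :: complex \<Rightarrow> 'a \<Rightarrow> 'a::complex_hilbert_space"
proof
  show "1 *\<^sub>C x = x" for x :: 'a
    using scaleR_scaleC[of 1 x] by simp
qed (simp_all add: scaleC_add_right scaleC_add_left scaleC_scaleC)

definition bounded_operators :: "('a::complex_hilbert_space \<Rightarrow> 'a) set" where
  "bounded_operators = {T. bounded_linear T \<and> (\<forall>c x. T (c *\<^sub>C x) = c *\<^sub>C T x)}"

definition adj :: "('a::complex_hilbert_space \<Rightarrow> 'a) \<Rightarrow> 'a \<Rightarrow> 'a" where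
  "adj T = (THE S. \<forall>x y. cinner (T x) y = cinner x (S y))"

definition orth_proj :: "'a::complex_hilbert_space set \<Rightarrow> 'a \<Rightarrow> 'a" where
  "orth_proj M x = (THE y. y \<in> M \<and> (\<forall>z\<in>M. cinner (x - y) z = 0))"

definition positive_operator :: "('a::complex_hilbert_space \<Rightarrow> 'a) \<Rightarrow> bool" where
  "positive_operator T \<longleftrightarrow> T \<in> bounded_operators \<and> (\<forall>x. cinner (T x) x \<in> \<real>\<^sub>\<ge>\<^sub>0)"

definition abs_operator :: "('a::complex_hilbert_space \<Rightarrow> 'a) \<Rightarrow> 'a \<Rightarrow> 'a" where
  "abs_operator T = (THE S. positive_operator S \<and> S \<circ> S = adj T \<circ> T)"

definition orthonormal_basis :: "'a::complex_hilbert_space set \<Rightarrow> bool" where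
  "orthonormal_basis E \<longleftrightarrow>
    (\<forall>e\<in>E. \<forall>f\<in>E. cinner e f = (if e = f then 1 else 0)) \<and>
    closure (complex_vector.span E) = UNIV"

definition some_basis :: "'a::complex_hilbert_space set" where
  "some_basis = (SOME E. orthonormal_basis E)"

text \<open>The trace occurs in two forms: with values in \<open>[0,\<infinity>]\<close> on positive operators, and with
  complex values on trace-class operators. They are given by the same sum, which does not depend
  on the basis in either case; \<open>op_trace_eq_pos_trace\<close> below records that they agree on
  positive operators of finite trace. Outside these classes the sums carry no meaning.\<close>

definition pos_trace :: "('a::complex_hilbert_space \<Rightarrow> 'a) \<Rightarrow> ennreal" where
  "pos_trace T = (\<Sum>\<^sub>\<infinity>e\<in>some_basis. ennreal (Re (cinner (T e) e)))"

definition op_trace :: "('a::complex_hilbert_space \<Rightarrow> 'a) \<Rightarrow> complex" where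
  "op_trace T = (\<Sum>\<^sub>\<infinity>e\<in>some_basis. cinner (T e) e)"

definition trace_class :: "('a::complex_hilbert_space \<Rightarrow> 'a) set" where
  "trace_class = {T \<in> bounded_operators. pos_trace (abs_operator T) < \<infinity>}"

lemma op_trace_eq_pos_trace:
  assumes "positive_operator T" and "pos_trace T < \<infinity>"
  shows "op_trace T = complex_of_real (enn2real (pos_trace T))"
proof -
  define g where "g = (\<lambda>e. Re (cinner (T e) e))"
  have "cinner (T e) e \<in> \<real>\<^sub>\<ge>\<^sub>0" for e
    using assms(1) by (simp add: positive_operator_def)
  then have g: "cinner (T e) e = complex_of_real (g e)" and g0: "g e \<ge> 0" for e
    by (auto simp: g_def complex_nonneg_Reals_iff complex_eq_iff)
  have hs: "((\<lambda>e. ennreal (g e)) has_sum pos_trace T) some_basis"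
    unfolding pos_trace_def g_def by (intro has_sum_infsum nonneg_summable_on_complete) simp
  have "(g has_sum enn2real (pos_trace T)) some_basis"
  proof -
    have "((\<lambda>F. enn2real (sum (\<lambda>e. ennreal (g e)) F)) \<longlongrightarrow> enn2real (pos_trace T))
        (finite_subsets_at_top some_basis)"
      using hs assms(2) unfolding has_sum_def
      by (intro tendsto_enn2real) (auto simp: less_top)
    moreover have "enn2real (sum (\<lambda>e. ennreal (g e)) F) = sum g F" for F
      using g0 by (simp add: sum_ennreal sum_nonneg)
    ultimately show ?thesis by (simp add: has_sum_def)
  qed
  then have "((\<lambda>e. complex_of_real (g e)) has_sum complex_of_real (enn2real (pos_trace T))) some_basis"
    by (rule has_sum_of_real)
  then show ?thesis
    unfolding op_trace_def g by (rule infsumI)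
qed

text \<open>Subalgebras need not contain the identity.\<close>

definition subalgebra :: "('a::complex_hilbert_space \<Rightarrow> 'a) set \<Rightarrow> bool" where
  "subalgebra B \<longleftrightarrow> B \<subseteq> bounded_operators \<and> (\<lambda>x. 0) \<in> B \<and>
    (\<forall>X\<in>B. \<forall>Y\<in>B. (\<lambda>x. X x + Y x) \<in> B \<and> X \<circ> Y \<in> B) \<and>
    (\<forall>c. \<forall>X\<in>B. (\<lambda>x. c *\<^sub>C X x) \<in> B)"

definition star_subalgebra :: "('a::complex_hilbert_space \<Rightarrow> 'a) set \<Rightarrow> bool" where
  "star_subalgebra B \<longleftrightarrow> subalgebra B \<and> (\<forall>X\<in>B. adj X \<in> B)"

definition vector_state :: "'a::complex_hilbert_space \<Rightarrow> ('a \<Rightarrow> 'a) \<Rightarrow> complex" where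
  "vector_state \<xi> X = cinner (X \<xi>) \<xi>"

definition op_prod :: "('a \<Rightarrow> 'a) list \<Rightarrow> 'a \<Rightarrow> 'a" where
  "op_prod Xs = foldr (\<circ>) Xs id"

definition boolean_independent ::
  "'i set \<Rightarrow> ('i \<Rightarrow> ('a::complex_hilbert_space \<Rightarrow> 'a) set) \<Rightarrow> (('a \<Rightarrow> 'a) \<Rightarrow> complex) \<Rightarrow> bool" where
  "boolean_independent K B \<phi> \<longleftrightarrow>
    (\<forall>k\<in>K. star_subalgebra (B k)) \<and>
    (\<forall>ks Xs. length ks \<ge> 2 \<and> set ks \<subseteq> K \<and> distinct_adj ks \<and>
        list_all2 (\<lambda>X k. X \<in> B k) Xs ks \<longrightarrow>
      \<phi> (op_prod Xs) = prod_list (map \<phi> Xs))"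

definition cyclic_boolean_independent ::
  "'i set \<Rightarrow> ('i \<Rightarrow> ('a::complex_hilbert_space \<Rightarrow> 'a) set) \<Rightarrow> (('a \<Rightarrow> 'a) \<Rightarrow> complex) \<Rightarrow>
    (('a \<Rightarrow> 'a) \<Rightarrow> complex) \<Rightarrow> bool" where
  "cyclic_boolean_independent K B \<phi> \<omega> \<longleftrightarrow>
    boolean_independent K B \<phi> \<and>
    (\<forall>ks Xs. length ks \<ge> 2 \<and> set ks \<subseteq> K \<and> distinct_adj ks \<and> last ks \<noteq> hd ks \<and>
        list_all2 (\<lambda>X k. X \<in> B k) Xs ks \<longrightarrow>
      \<omega> (op_prod Xs) = prod_list (map \<phi> Xs))"

definition trace_on ::
  "('a::complex_hilbert_space \<Rightarrow> 'a) set \<Rightarrow> (('a \<Rightarrow> 'a) \<Rightarrow> ennreal) \<Rightarrow> bool" where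
  "trace_on B \<tau> \<longleftrightarrow>
    (\<forall>X\<in>B. \<forall>Y\<in>B. positive_operator X \<and> positive_operator Y \<longrightarrow>
      \<tau> (\<lambda>x. X x + Y x) = \<tau> X + \<tau> Y) \<and>
    (\<forall>X\<in>B. \<forall>r\<ge>0. positive_operator X \<longrightarrow> \<tau> (\<lambda>x. r *\<^sub>R X x) = ennreal r * \<tau> X) \<and>
    (\<forall>X\<in>B. \<tau> (adj X \<circ> X) = \<tau> (X \<circ> adj X))"

definition semifinite_trace_on ::
  "('a::complex_hilbert_space \<Rightarrow> 'a) set \<Rightarrow> (('a \<Rightarrow> 'a) \<Rightarrow> ennreal) \<Rightarrow> bool" where
  "semifinite_trace_on B \<tau> \<longleftrightarrow> trace_on B \<tau> \<and>
    (\<forall>X\<in>B. positive_operator X \<and> X \<noteq> (\<lambda>x. 0) \<longrightarrow>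
      (\<exists>Y\<in>B. positive_operator Y \<and> Y \<noteq> (\<lambda>x. 0) \<and>
        positive_operator (\<lambda>x. X x - Y x) \<and> \<tau> Y < \<infinity>))"

end

theory Submission
  imports Defs
begin

text \<open>
The whole argument rests on one observation: on the cyclic subspace \<open>H_hat\<close>, a product \<open>X Y\<close> of
operators coming from different members of the family has rank at most one. Let \<open>P\<^sub>0\<close> be the projection
onto the line of \<open>\<xi>\<close>. For words \<open>Z\<close>, \<open>W\<close> in the letters, Boolean independence gives
\<open>\<phi>(Z\<^sup>* X Y W) = \<phi>(Z\<^sup>* X) \<phi>(Y W)\<close>, because a product of two alternating words is again an
alternating word once adjacent letters with equal index are merged. The right-hand side is
\<open>\<phi>(Z\<^sup>* X P\<^sub>0 Y W)\<close>, so \<open>X Y\<close> and \<open>X P\<^sub>0 Y\<close> have the same matrix coefficients on the vectors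
\<open>W \<xi>\<close>, and these span a dense subspace of \<open>H_hat\<close>. This is \<open>word_factorization\<close>.

Cyclic-Boolean independence follows at once. A cyclically alternating product is \<open>X T\<close> with first
letter \<open>X\<close> and remaining word \<open>T\<close>. On \<open>H_hat\<close> it is \<open>v \<mapsto> \<langle>T v, \<xi>\<rangle> X \<xi>\<close>, whose trace is
\<open>\<langle>T X \<xi>, \<xi>\<rangle> = \<phi>(T X)\<close>. Since the last index differs from the first, \<open>T X\<close> is alternating as well
and \<open>\<phi>(T X) = \<phi>(T) \<phi>(X)\<close> is the required product (\<open>op_trace_cyclic_word\<close>).

The trace property comes from \<open>Tr(T\<^sup>* T) = Tr(T T\<^sup>*)\<close>, applied to \<open>T = X P_hat\<close>; here \<open>P_hat\<close>
commutes with the algebra since \<open>H_hat\<close> is invariant under it and the algebra is self-adjoint. For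
semifiniteness let \<open>X\<close> be positive with \<open>X v \<noteq> 0\<close> for some \<open>v = Z \<xi>\<close>. The Cauchy--Schwarz
inequality for the form \<open>\<langle>X x, y\<rangle>\<close> says that \<open>X\<close> dominates the rank-one operator
\<open>x \<mapsto> \<langle>x, X v\<rangle> X v / \<langle>X v, v\<rangle>\<close>, which is a multiple of \<open>X Z P\<^sub>0 Z\<^sup>* X\<close> and so lies in the algebra
(\<open>rank_one_below\<close>). If there is no such \<open>v\<close>, then \<open>X\<close> vanishes on \<open>H_hat\<close> and has trace \<open>0\<close>.

It remains to see that trace-class operators form a star-ideal. Their definition through the
absolute value requires existence and uniqueness of positive square roots, and the ideal property is
obtained from the description of trace-class operators as products of two Hilbert--Schmidt operators.
The passage between an operator and its absolute value uses the factorization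
\<open>douglas_factorization\<close> in place of the polar decomposition. One minimisation argument,
\<open>riesz_real_subspace\<close>, yields projections, adjoints and this factorization.
\<close>

section \<open>The complex inner product\<close>

lemma cinner_add_right: "cinner x (y + z) = cinner x y + cinner x (z::'a::complex_hilbert_space)"
  by (subst (1 2 3) cinner_commute) (simp add: cinner_add_left)

lemma cinner_scaleC_right: "cinner x (c *\<^sub>C y) = cnj c * cinner x (y::'a::complex_hilbert_space)"
  by (subst (1 2) cinner_commute) (simp add: cinner_scaleC_left)

lemma norm_eq_cinner: "cinner x x = complex_of_real ((norm x)\<^sup>2)"
proof -
  have "Im (cinner x x) = 0"
    using arg_cong[OF cinner_commute[of x x], of Im] by simp
  then show ?thesis
    by (simp add: complex_eq_iff power2_norm_eq_inner inner_eq_Re_cinner)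
qed

lemma cmod_cinner_self: "cmod (cinner x x) = (norm x)\<^sup>2"
  by (simp add: norm_eq_cinner norm_power)

lemma norm_scaleC: "norm (c *\<^sub>C x) = cmod c * norm (x::'a::complex_hilbert_space)"
proof -
  have "complex_of_real ((norm (c *\<^sub>C x))\<^sup>2) = complex_of_real ((cmod c * norm x)\<^sup>2)"
    unfolding norm_eq_cinner[symmetric] cinner_scaleC_left cinner_scaleC_right
    by (simp add: norm_eq_cinner power_mult_distrib complex_norm_square ac_simps del: of_real_power)
  then have "(norm (c *\<^sub>C x))\<^sup>2 = (cmod c * norm x)\<^sup>2"
    by (simp only: of_real_eq_iff)
  then show ?thesis
    by (simp add: power2_eq_iff_nonneg)
qed

text \<open>Rotating \<open>x\<close> by a phase makes \<open>cinner x y\<close> real and nonnegative, which reduces the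
  inequality to the one for the real inner product.\<close>

lemma cmod_cinner_le: "cmod (cinner x y) \<le> norm x * norm (y::'a::complex_hilbert_space)"
proof (cases "cinner x y = 0")
  case False
  define c where "c = cnj (sgn (cinner x y))"
  have "c * cinner x y = complex_of_real (cmod (cinner x y))"
    using False by (simp add: c_def sgn_eq field_simps complex_norm_square[symmetric] power2_eq_square)
  then have "cmod (cinner x y) = inner (c *\<^sub>C x) y"
    by (simp add: inner_eq_Re_cinner cinner_scaleC_left)
  also have "\<dots> \<le> norm (c *\<^sub>C x) * norm y"
    by (rule norm_cauchy_schwarz)
  also have "\<dots> = norm x * norm y"
    using False by (simp add: norm_scaleC c_def norm_sgn)
  finally show ?thesis .
qed auto

lemma bounded_bilinear_cinner: "bounded_bilinear (cinner :: 'a::complex_hilbert_space \<Rightarrow> _)"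
proof
  show "\<exists>K. \<forall>a b :: 'a. norm (cinner a b) \<le> norm a * norm b * K"
    by (rule exI[of _ 1]) (simp add: cmod_cinner_le)
qed (simp_all add: cinner_add_left cinner_add_right scaleR_scaleC cinner_scaleC_left
      cinner_scaleC_right scaleR_conv_of_real)

lemma bounded_bilinear_scaleC: "bounded_bilinear (scaleC :: _ \<Rightarrow> 'a::complex_hilbert_space \<Rightarrow> _)"
proof
  show "\<exists>K. \<forall>a (b :: 'a). norm (a *\<^sub>C b) \<le> norm a * norm b * K"
    by (rule exI[of _ 1]) (simp add: norm_scaleC)
qed (simp_all add: scaleC_add_left scaleC_add_right scaleR_scaleC scaleC_scaleC
      scaleR_conv_of_real mult.commute)

interpretation cinner: bounded_bilinear "cinner :: 'a::complex_hilbert_space \<Rightarrow> _"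
  by (rule bounded_bilinear_cinner)

interpretation scaleC: bounded_bilinear "scaleC :: _ \<Rightarrow> 'a::complex_hilbert_space \<Rightarrow> _"
  by (rule bounded_bilinear_scaleC)

lemma cinner_zeroI: "(\<And>y. cinner x y = 0) \<Longrightarrow> x = 0"
  using norm_eq_cinner[of x] by simp

lemma cinner_eqI_left: "(\<And>y. cinner x y = cinner x' y) \<Longrightarrow> x = x'"
  using cinner_zeroI[of "x - x'"] by (simp add: cinner.diff_left)

lemma cinner_eqI_right: "(\<And>y. cinner y x = cinner y x') \<Longrightarrow> x = x'"
  by (rule cinner_eqI_left, subst (1 2) cinner_commute) simp

lemma cinner_eq_zero_commute: "cinner x y = 0 \<longleftrightarrow> cinner y x = 0"
  by (subst cinner_commute) simp

lemma orthogonal_to_closure: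
  assumes "\<And>z. z \<in> M \<Longrightarrow> cinner x z = 0" and "z \<in> closure M"
  shows "cinner x z = 0"
proof -
  have "closed {z. cinner x z = 0}"
    by (intro closed_Collect_eq cinner.continuous_on continuous_on_const continuous_on_id)
  then have "closure M \<subseteq> {z. cinner x z = 0}"
    using assms(1) by (intro closure_minimal) auto
  then show ?thesis
    using assms(2) by auto
qed

lemma subspace_complex_imp_real: "complex_vector.subspace M \<Longrightarrow> subspace M"
  by (simp add: subspace_def complex_vector.subspace_def scaleR_scaleC)

lemma closure_subspace_real:
  fixes M :: "'b::real_normed_vector set"
  assumes "subspace M" shows "subspace (closure M)"
proof (rule subspaceI)
  show "0 \<in> closure M"
    using assms closure_subset subspace_0 by blast
  show "x + y \<in> closure M" if xy: "x \<in> closure M" "y \<in> closure M" for x y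
  proof -
    obtain s t where "\<And>n. s n \<in> M" "s \<longlonglongrightarrow> x" "\<And>n. t n \<in> M" "t \<longlonglongrightarrow> y"
      using xy unfolding closure_sequential by blast
    then have "\<And>n. s n + t n \<in> M" "(\<lambda>n. s n + t n) \<longlonglongrightarrow> x + y"
      using assms by (auto intro: subspace_add tendsto_add)
    then show ?thesis
      unfolding closure_sequential by (intro exI[of _ "\<lambda>n. s n + t n"]) simp
  qed
  show "r *\<^sub>R x \<in> closure M" if x: "x \<in> closure M" for r x
  proof -
    obtain s where "\<And>n. s n \<in> M" "s \<longlonglongrightarrow> x"
      using x unfolding closure_sequential by blast
    then have "\<And>n. r *\<^sub>R s n \<in> M" "(\<lambda>n. r *\<^sub>R s n) \<longlonglongrightarrow> r *\<^sub>R x"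
      using assms by (auto intro: subspace_scale tendsto_intros)
    then show ?thesis
      unfolding closure_sequential by (intro exI[of _ "\<lambda>n. r *\<^sub>R s n"]) simp
  qed
qed

lemma closure_complex_subspace:
  assumes "complex_vector.subspace M" shows "complex_vector.subspace (closure M)"
proof -
  have M: "subspace (closure M)"
    using assms by (intro closure_subspace_real subspace_complex_imp_real)
  have "c *\<^sub>C x \<in> closure M" if x: "x \<in> closure M" for c x
  proof -
    obtain s where s: "\<forall>n. s n \<in> M" "s \<longlonglongrightarrow> x"
      using x unfolding closure_sequential by blast
    have "(\<lambda>n. c *\<^sub>C s n) \<longlonglongrightarrow> c *\<^sub>C x"
      by (intro scaleC.tendsto tendsto_const s)
    moreover have "c *\<^sub>C s n \<in> M" for n
      using assms s by (simp add: complex_vector.subspace_def)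
    ultimately show ?thesis
      unfolding closure_sequential by (intro exI[of _ "\<lambda>n. c *\<^sub>C s n"]) simp
  qed
  with M show ?thesis
    by (simp add: subspace_def complex_vector.subspace_def)
qed


section \<open>Riesz representation on a subspace\<close>

text \<open>The vector \<open>m\<close> minimises the functional \<open>J x = \<parallel>x\<parallel>\<^sup>2 - 2 f x\<close> over \<open>M\<close>: a minimising sequence
  is Cauchy by the parallelogram law, and \<open>f x = inner x m\<close> is the vanishing of the derivative of
  \<open>J\<close> at \<open>m\<close> in direction \<open>x\<close>. The subspace may fail to be closed; then \<open>m\<close> lies in its closure.
  This generality serves for ranges of operators.\<close>

lemma riesz_real_subspace:
  fixes M :: "'b::{real_inner,complete_space} set" and f :: "'b \<Rightarrow> real"
  assumes M: "subspace M"
    and add: "\<And>x y. x \<in> M \<Longrightarrow> y \<in> M \<Longrightarrow> f (x + y) = f x + f y"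
    and scale: "\<And>r x. x \<in> M \<Longrightarrow> f (r *\<^sub>R x) = r * f x"
    and bound: "\<And>x. x \<in> M \<Longrightarrow> \<bar>f x\<bar> \<le> K * norm x"
  obtains m where "m \<in> closure M" and "\<And>x. x \<in> M \<Longrightarrow> f x = inner x m"
proof -
  define J where "J x = (norm x)\<^sup>2 - 2 * f x" for x
  define d where "d = (INF x\<in>M. J x)"
  have "- K\<^sup>2 \<le> J x" if "x \<in> M" for x
  proof -
    have "0 \<le> (norm x - K)\<^sup>2" by simp
    moreover have "f x \<le> K * norm x" using bound[OF that] by simp
    ultimately show ?thesis by (simp add: J_def power2_diff mult.commute)
  qed
  then have bdd: "bdd_below (J ` M)"
    by (intro bdd_belowI2)
  have dle: "d \<le> J x" if "x \<in> M" for x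
    unfolding d_def by (rule cINF_lower[OF bdd that])
  have ne: "M \<noteq> {}" using M subspace_0 by auto
  have "\<exists>x\<in>M. J x < d + inverse (real (Suc n))" for n
  proof (rule ccontr)
    assume "\<not> ?thesis"
    then have "d + inverse (real (Suc n)) \<le> (INF x\<in>M. J x)"
      by (intro cINF_greatest[OF ne]) (simp add: not_less)
    moreover have "0 < inverse (real (Suc n))" by simp
    ultimately show False unfolding d_def[symmetric] by linarith
  qed
  then obtain s where sM: "\<And>n. s n \<in> M" and sJ: "\<And>n. J (s n) < d + inverse (real (Suc n))"
    by metis
  \<comment> \<open>The parallelogram law, written in terms of \<open>J\<close>.\<close>
  have para: "(norm (a - b))\<^sup>2 = 2 * J a + 2 * J b - 4 * J ((1/2) *\<^sub>R (a + b))"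
    if "a \<in> M" "b \<in> M" for a b
  proof -
    have "f ((1/2) *\<^sub>R (a + b)) = (1/2) * (f a + f b)"
      using that M by (simp add: add scale subspace_add del: scaleR_add_right)
    then show ?thesis
      by (simp add: J_def power2_norm_eq_inner inner_diff inner_add inner_commute[of b a] algebra_simps)
  qed
  have close: "(norm (s m - s n))\<^sup>2 \<le> 2 * inverse (real (Suc m)) + 2 * inverse (real (Suc n))" for m n
  proof -
    have "d \<le> J ((1/2) *\<^sub>R (s m + s n))"
      using M sM by (intro dle) (simp add: subspace_add subspace_scale)
    then show ?thesis
      using para[OF sM sM, of m n] sJ[of m] sJ[of n] by linarith
  qed
  have "Cauchy s"
  proof (rule metric_CauchyI)
    fix e :: real assume "0 < e"
    then obtain N where N: "inverse (real (Suc N)) < e\<^sup>2 / 4"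
      using reals_Archimedean[of "e\<^sup>2 / 4"] by auto
    have "dist (s m) (s n) < e" if "m \<ge> N" "n \<ge> N" for m n
    proof -
      have "inverse (real (Suc m)) \<le> inverse (real (Suc N))" "inverse (real (Suc n)) \<le> inverse (real (Suc N))"
        using that by (simp_all add: le_imp_inverse_le)
      then have "(norm (s m - s n))\<^sup>2 < e\<^sup>2"
        using close[of m n] N by linarith
      then show ?thesis
        using \<open>0 < e\<close> by (simp add: dist_norm power_less_imp_less_base)
    qed
    then show "\<exists>N. \<forall>m\<ge>N. \<forall>n\<ge>N. dist (s m) (s n) < e" by blast
  qed
  then obtain l where l: "s \<longlonglongrightarrow> l"
    using Cauchy_convergent convergent_def by blast
  have "f x = inner x l" if "x \<in> M" for x
  proof (rule ccontr)
    assume neq: "f x \<noteq> inner x l"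
    define q where "q = inner l x - f x"
    define N where "N = (norm x)\<^sup>2"
    have q: "q \<noteq> 0" using neq by (simp add: q_def inner_commute)
    have N: "N \<ge> 0" by (simp add: N_def)
    have "0 \<le> 2 * t * q + t\<^sup>2 * N" for t
    proof (rule LIMSEQ_le_const)
      have "(\<lambda>n. inverse (real (Suc n)) + 2 * t * (inner (s n) x - f x) + t\<^sup>2 * N)
          \<longlonglongrightarrow> 0 + 2 * t * (inner l x - f x) + t\<^sup>2 * N"
        by (intro tendsto_intros l LIMSEQ_inverse_real_of_nat)
      then show "(\<lambda>n. inverse (real (Suc n)) + 2 * t * (inner (s n) x - f x) + t\<^sup>2 * N)
          \<longlonglongrightarrow> 2 * t * q + t\<^sup>2 * N"
        by (simp add: q_def)
      have "0 \<le> inverse (real (Suc n)) + 2 * t * (inner (s n) x - f x) + t\<^sup>2 * N" for n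
      proof -
        have tx: "t *\<^sub>R x \<in> M"
          using that M by (simp add: subspace_scale)
        have "d \<le> J (s n + t *\<^sub>R x)"
          using sM[of n] tx M by (intro dle) (simp add: subspace_add)
        also have "\<dots> = J (s n) + 2 * t * (inner (s n) x - f x) + t\<^sup>2 * N"
          using that sM[of n] tx
          by (simp add: J_def add scale N_def power2_norm_eq_inner inner_add inner_commute[of x "s n"]
              algebra_simps) (simp add: power2_eq_square)
        finally show ?thesis using sJ[of n] by linarith
      qed
      then show "\<exists>N'. \<forall>n\<ge>N'. 0 \<le> inverse (real (Suc n)) + 2 * t * (inner (s n) x - f x) + t\<^sup>2 * N"
        by blast
    qed
    \<comment> \<open>The exact minimiser in \<open>t\<close> would be \<open>- q / N\<close>; the shift keeps the denominator positive.\<close>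
    from this[of "- q / (N + 1)"] have "0 \<le> 2 * (- q / (N + 1)) * q + (- q / (N + 1))\<^sup>2 * N" .
    also have "\<dots> = - (q\<^sup>2 * (N + 2) / (N + 1)\<^sup>2)"
      using N by (simp add: divide_simps power2_eq_square) (simp add: algebra_simps)
    finally have "0 \<le> - (q\<^sup>2 * (N + 2) / (N + 1)\<^sup>2)" .
    moreover have "0 < q\<^sup>2 * (N + 2) / (N + 1)\<^sup>2"
      using q N by simp
    ultimately show False by simp
  qed
  moreover have "l \<in> closure M"
    unfolding closure_sequential using sM l by (intro exI[of _ s]) simp
  ultimately show thesis by (rule that[rotated])
qed

text \<open>A complex linear functional is determined by its real part: the imaginary part at \<open>x\<close> is the
  negative of the real part at \<open>\<i> x\<close>.\<close>

lemma riesz_subspace: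
  fixes g :: "'a::complex_hilbert_space \<Rightarrow> complex"
  assumes M: "complex_vector.subspace M"
    and add: "\<And>x y. x \<in> M \<Longrightarrow> y \<in> M \<Longrightarrow> g (x + y) = g x + g y"
    and scale: "\<And>c x. x \<in> M \<Longrightarrow> g (c *\<^sub>C x) = c * g x"
    and bound: "\<And>x. x \<in> M \<Longrightarrow> cmod (g x) \<le> K * norm x"
  obtains m where "m \<in> closure M" and "\<And>x. x \<in> M \<Longrightarrow> g x = cinner x m"
proof -
  obtain m where m: "m \<in> closure M" and re: "\<And>x. x \<in> M \<Longrightarrow> Re (g x) = inner x m"
  proof (rule riesz_real_subspace[of M "\<lambda>x. Re (g x)" K])
    show "\<bar>Re (g x)\<bar> \<le> K * norm x" if "x \<in> M" for x
      using abs_Re_le_cmod bound[OF that] by (rule order_trans)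
  qed (use M in \<open>auto simp: add scale scaleR_scaleC subspace_complex_imp_real\<close>)
  have "g x = cinner x m" if "x \<in> M" for x
  proof (rule complex_eqI)
    show "Re (g x) = Re (cinner x m)"
      using re[OF that] by (simp add: inner_eq_Re_cinner)
    have "\<i> *\<^sub>C x \<in> M"
      using M that by (simp add: complex_vector.subspace_def)
    from re[OF this] show "Im (g x) = Im (cinner x m)"
      using that by (simp add: scale inner_eq_Re_cinner cinner_scaleC_left)
  qed
  with m show thesis by (rule that)
qed

section \<open>Orthogonal projections and adjoints\<close>

lemma orth_proj_eqI:
  assumes M: "complex_vector.subspace M" and "y \<in> M" "\<And>z. z \<in> M \<Longrightarrow> cinner (x - y) z = 0"
  shows "orth_proj M x = y"
  unfolding orth_proj_def
proof (rule the_equality)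
  fix y' assume y': "y' \<in> M \<and> (\<forall>z\<in>M. cinner (x - y') z = 0)"
  then have "y - y' \<in> M"
    using assms by (simp add: complex_vector.subspace_diff)
  then have "cinner (x - y') (y - y') = 0" "cinner (x - y) (y - y') = 0"
    using y' assms by auto
  then have "cinner (y - y') (y - y') = 0"
    by (simp add: cinner.diff_left)
  then show "y' = y"
    by (simp add: norm_eq_cinner)
qed (use assms in auto)

text \<open>The projection of \<open>x\<close> represents the functional \<open>z \<mapsto> cinner z x\<close> on \<open>M\<close>.\<close>

lemma orth_proj:
  assumes M: "complex_vector.subspace M" "closed M"
  shows orth_proj_mem: "orth_proj M x \<in> M"
    and orth_proj_orthogonal: "z \<in> M \<Longrightarrow> cinner (x - orth_proj M x) z = 0"
proof -
  obtain m where m: "m \<in> closure M" "\<And>z. z \<in> M \<Longrightarrow> cinner z x = cinner z m"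
    by (rule riesz_subspace[of M "\<lambda>z. cinner z x" "norm x"])
      (use M in \<open>auto simp: cinner_add_left cinner_scaleC_left mult.commute[of "norm x"] cmod_cinner_le\<close>)
  have mM: "m \<in> M" using m M by (simp add: closure_closed)
  have o: "cinner (x - m) z = 0" if "z \<in> M" for z
    using m(2)[OF that] by (simp add: cinner_eq_zero_commute[of _ z] cinner.diff_right)
  have "orth_proj M x = m"
    using M(1) mM o by (rule orth_proj_eqI)
  then show "orth_proj M x \<in> M" "z \<in> M \<Longrightarrow> cinner (x - orth_proj M x) z = 0"
    using mM o by auto
qed

lemma orth_proj_self_adjoint:
  assumes "complex_vector.subspace M" "closed M"
  shows "cinner (orth_proj M x) y = cinner x (orth_proj M y)"
proof -
  have "cinner (x - orth_proj M x) (orth_proj M y) = 0" "cinner (y - orth_proj M y) (orth_proj M x) = 0"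
    using orth_proj[OF assms] by auto
  then have "cinner x (orth_proj M y) = cinner (orth_proj M x) (orth_proj M y)"
    "cinner (orth_proj M x) y = cinner (orth_proj M x) (orth_proj M y)"
    unfolding cinner_eq_zero_commute[of "y - _"] by (simp_all add: cinner.diff_left cinner.diff_right)
  then show ?thesis by simp
qed

lemma orth_proj_fixes:
  assumes "complex_vector.subspace M" "x \<in> M" shows "orth_proj M x = x"
  by (rule orth_proj_eqI) (use assms in \<open>auto simp: cinner.zero_left\<close>)

lemma bounded_operatorsI:
  assumes "\<And>x y. T (x + y) = T x + T y" "\<And>c x. T (c *\<^sub>C x) = c *\<^sub>C T x" "\<And>x. norm (T x) \<le> K * norm x"
  shows "T \<in> bounded_operators"
  unfolding bounded_operators_def
  using assms by (auto intro!: bounded_linear_intro[of _ K] simp: scaleR_scaleC mult.commute)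

lemma bounded_operatorsD:
  assumes "T \<in> bounded_operators"
  shows bounded_operators_linear: "bounded_linear T"
    and bounded_operators_add: "T (x + y) = T x + T y"
    and bounded_operators_diff: "T (x - y) = T x - T y"
    and bounded_operators_scaleC: "T (c *\<^sub>C x) = c *\<^sub>C T x"
    and bounded_operators_zero: "T 0 = 0"
proof -
  show bl: "bounded_linear T" using assms by (simp add: bounded_operators_def)
  then interpret bounded_linear T .
  show "T (x + y) = T x + T y" by (rule add)
  show "T (x - y) = T x - T y" by (rule diff)
  show "T 0 = 0" by (rule zero)
  show "T (c *\<^sub>C x) = c *\<^sub>C T x" using assms by (simp add: bounded_operators_def)
qed

lemma bounded_operators_bound:
  assumes "T \<in> bounded_operators"
  obtains K where "K \<ge> 0" "\<And>x. norm (T x) \<le> K * norm x"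
  using bounded_linear.nonneg_bounded[OF bounded_operators_linear[OF assms]]
  by (metis mult.commute)

lemma bounded_operators_id: "id \<in> bounded_operators"
  by (rule bounded_operatorsI[of _ 1]) auto

lemma bounded_operators_zero_op: "(\<lambda>x. 0) \<in> bounded_operators"
  by (rule bounded_operatorsI[of _ 1]) auto

lemma bounded_operators_comp:
  assumes "S \<in> bounded_operators" "T \<in> bounded_operators"
  shows "S \<circ> T \<in> bounded_operators"
  using assms bounded_linear_compose[of S T] unfolding bounded_operators_def by (auto simp: o_def)

lemma bounded_operators_plus:
  assumes "S \<in> bounded_operators" "T \<in> bounded_operators"
  shows "(\<lambda>x. S x + T x) \<in> bounded_operators"
  using assms unfolding bounded_operators_def by (auto intro: bounded_linear_add simp: scaleC_add_right)

lemma bounded_operators_minus: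
  assumes "S \<in> bounded_operators" "T \<in> bounded_operators"
  shows "(\<lambda>x. S x - T x) \<in> bounded_operators"
  using assms unfolding bounded_operators_def
  by (auto intro: bounded_linear_sub simp: complex_vector.scale_right_diff_distrib)

lemma bounded_operators_scale:
  assumes "T \<in> bounded_operators"
  shows "(\<lambda>x. c *\<^sub>C T x) \<in> bounded_operators"
  using assms bounded_linear_compose[OF scaleC.bounded_linear_right, of T c]
  unfolding bounded_operators_def by (auto simp: scaleC_scaleC mult.commute)

lemma bounded_operators_orth_proj:
  assumes M: "complex_vector.subspace M" "closed M"
  shows "orth_proj M \<in> bounded_operators"
proof (rule bounded_operatorsI[of _ 1])
  note P = orth_proj[OF M]
  show "orth_proj M (x + y) = orth_proj M x + orth_proj M y" for x y
  proof (rule orth_proj_eqI[OF M(1)])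
    show "orth_proj M x + orth_proj M y \<in> M"
      using M P by (simp add: complex_vector.subspace_add)
    show "cinner (x + y - (orth_proj M x + orth_proj M y)) z = 0" if "z \<in> M" for z
      using P(2)[OF that, of x] P(2)[OF that, of y] by (simp add: add_diff_add cinner_add_left)
  qed
  show "orth_proj M (c *\<^sub>C x) = c *\<^sub>C orth_proj M x" for c x
  proof (rule orth_proj_eqI[OF M(1)])
    show "c *\<^sub>C orth_proj M x \<in> M"
      using M P by (simp add: complex_vector.subspace_scale)
    show "cinner (c *\<^sub>C x - c *\<^sub>C orth_proj M x) z = 0" if "z \<in> M" for z
      using P(2)[OF that, of x]
      by (simp add: complex_vector.scale_right_diff_distrib[symmetric] cinner_scaleC_left)
  qed
  show "norm (orth_proj M x) \<le> 1 * norm x" for x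
  proof -
    have "cinner (orth_proj M x) (orth_proj M x) = cinner x (orth_proj M x)"
      using P(2)[OF P(1), of x x] by (simp add: cinner.diff_left)
    then have "(norm (orth_proj M x))\<^sup>2 = cmod (cinner x (orth_proj M x))"
      by (simp only: cmod_cinner_self[symmetric])
    also have "\<dots> \<le> norm x * norm (orth_proj M x)"
      by (rule cmod_cinner_le)
    finally show ?thesis
      by (cases "norm (orth_proj M x) = 0") (simp_all add: power2_eq_square)
  qed
qed

lemma adj_eqI:
  assumes "\<And>x y. cinner (T x) y = cinner x (S y)"
  shows "adj T = S"
  unfolding adj_def
proof (rule the_equality)
  fix S' assume "\<forall>x y. cinner (T x) y = cinner x (S' y)"
  then show "S' = S"
    by (intro ext cinner_eqI_right) (simp flip: assms)
qed (use assms in auto)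

lemma cinner_adj_right:
  assumes T: "T \<in> bounded_operators"
  shows "cinner (T x) y = cinner x (adj T y)"
proof -
  obtain K where K: "K \<ge> 0" "\<And>x. norm (T x) \<le> K * norm x"
    using bounded_operators_bound[OF T] by metis
  have "\<exists>m. \<forall>x. cinner (T x) y = cinner x m" for y
  proof -
    have "cmod (cinner (T x) y) \<le> (K * norm y) * norm x" for x
    proof -
      have "cmod (cinner (T x) y) \<le> norm (T x) * norm y"
        by (rule cmod_cinner_le)
      also have "\<dots> \<le> (K * norm x) * norm y"
        by (intro mult_right_mono K) auto
      finally show ?thesis by (simp add: ac_simps)
    qed
    then obtain m where "\<And>x. cinner (T x) y = cinner x m"
      using riesz_subspace[of UNIV "\<lambda>x. cinner (T x) y" "K * norm y"]
      by (metis UNIV_I bounded_operators_add[OF T] bounded_operators_scaleC[OF T]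
          cinner_add_left cinner_scaleC_left complex_vector.subspace_UNIV)
    then show ?thesis by blast
  qed
  then obtain S where "\<And>x y. cinner (T x) y = cinner x (S y)" by metis
  moreover from this have "adj T = S" by (rule adj_eqI)
  ultimately show ?thesis by simp
qed

lemma cinner_adj_left:
  assumes T: "T \<in> bounded_operators"
  shows "cinner (adj T x) y = cinner x (T y)"
  by (subst (1 2) cinner_commute) (simp add: cinner_adj_right[OF T])

lemma bounded_operators_adj:
  assumes T: "T \<in> bounded_operators"
  shows "adj T \<in> bounded_operators"
proof -
  obtain K where K: "K \<ge> 0" "\<And>x. norm (T x) \<le> K * norm x"
    using bounded_operators_bound[OF T] by metis
  show ?thesis
  proof (rule bounded_operatorsI[of _ K])
    show "adj T (x + y) = adj T x + adj T y" for x y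
      by (rule cinner_eqI_left) (simp add: cinner_adj_left[OF T] cinner_add_left)
    show "adj T (c *\<^sub>C x) = c *\<^sub>C adj T x" for c x
      by (rule cinner_eqI_left) (simp add: cinner_adj_left[OF T] cinner_scaleC_left)
    show "norm (adj T x) \<le> K * norm x" for x
    proof -
      have "(norm (adj T x))\<^sup>2 = cmod (cinner x (T (adj T x)))"
        unfolding cmod_cinner_self[symmetric] by (subst cinner_adj_left[OF T]) (rule refl)
      also have "\<dots> \<le> norm x * norm (T (adj T x))"
        by (rule cmod_cinner_le)
      also have "\<dots> \<le> norm x * (K * norm (adj T x))"
        by (intro mult_left_mono K) simp
      finally have le: "norm (adj T x) * norm (adj T x) \<le> (K * norm x) * norm (adj T x)"
        by (simp only: power2_eq_square mult.assoc mult.left_commute)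
      show ?thesis
      proof (cases "norm (adj T x) = 0")
        case True
        then show ?thesis using K(1) by (simp only: mult_nonneg_nonneg norm_ge_zero)
      next
        case False
        then have "0 < norm (adj T x)" by simp
        with le show ?thesis by (rule mult_right_le_imp_le)
      qed
    qed
  qed
qed

lemma adj_adj: "T \<in> bounded_operators \<Longrightarrow> adj (adj T) = T"
  by (rule adj_eqI) (simp add: cinner_adj_left)

lemma adj_comp:
  "S \<in> bounded_operators \<Longrightarrow> T \<in> bounded_operators \<Longrightarrow> adj (S \<circ> T) = adj T \<circ> adj S"
  by (rule adj_eqI) (simp add: cinner_adj_right)

lemma adj_plus:
  "S \<in> bounded_operators \<Longrightarrow> T \<in> bounded_operators \<Longrightarrow> adj (\<lambda>x. S x + T x) = (\<lambda>x. adj S x + adj T x)"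
  by (rule adj_eqI) (simp add: cinner_adj_right cinner_add_left cinner_add_right)

lemma adj_scale:
  "T \<in> bounded_operators \<Longrightarrow> adj (\<lambda>x. c *\<^sub>C T x) = (\<lambda>x. cnj c *\<^sub>C adj T x)"
  by (rule adj_eqI) (simp add: cinner_adj_right cinner_scaleC_left cinner_scaleC_right)

lemma adj_zero_op: "adj (\<lambda>x. 0 :: 'a::complex_hilbert_space) = (\<lambda>x. 0)"
  by (rule adj_eqI) (simp add: cinner.zero_left cinner.zero_right)

section \<open>Orthonormal bases and Parseval's identity\<close>

definition orthonormal :: "'a::complex_hilbert_space set \<Rightarrow> bool" where
  "orthonormal E \<longleftrightarrow> (\<forall>e\<in>E. \<forall>f\<in>E. cinner e f = (if e = f then 1 else 0))"

lemma orthonormalD: "orthonormal E \<Longrightarrow> e \<in> E \<Longrightarrow> f \<in> E \<Longrightarrow> cinner e f = (if e = f then 1 else 0)"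
  by (simp add: orthonormal_def)

lemma orthonormal_insert_normalized:
  assumes E: "orthonormal E" and u: "u \<noteq> 0" "\<And>e. e \<in> E \<Longrightarrow> cinner u e = 0"
  shows "orthonormal (insert (complex_of_real (1 / norm u) *\<^sub>C u) E)"
proof -
  have "cinner e u = 0" if "e \<in> E" for e
    using u(2)[OF that] cinner_eq_zero_commute by blast
  moreover have "e \<noteq> complex_of_real (1 / norm u) *\<^sub>C u" if "e \<in> E" for e
    using orthonormalD[OF E that that] u(2)[OF that] by (auto simp: cinner_scaleC_left)
  ultimately show ?thesis
    using E u by (auto simp: orthonormal_def cinner_scaleC_left cinner_scaleC_right norm_eq_cinner
        power2_eq_square)
qed

text \<open>A maximal orthonormal set is a basis: the closure of its span contains every \<open>x\<close>, since
  otherwise the normalised component of \<open>x\<close> orthogonal to it could be added.\<close>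

lemma orthonormal_basis_exists: "\<exists>E::'a::complex_hilbert_space set. orthonormal_basis E"
proof -
  define \<O> where "\<O> = {E::'a set. orthonormal E}"
  have "\<Union>C \<in> \<O>" if C: "subset.chain \<O> C" for C
  proof -
    have "cinner e f = (if e = f then 1 else 0)" if ef: "e \<in> \<Union>C" "f \<in> \<Union>C" for e f
    proof -
      obtain X Y where "X \<in> C" "Y \<in> C" "e \<in> X" "f \<in> Y"
        using ef by auto
      then obtain Z where "Z \<in> C" "e \<in> Z" "f \<in> Z"
        using C unfolding subset_chain_def by (metis subsetD)
      moreover from this have "orthonormal Z"
        using C by (auto simp: subset_chain_def \<O>_def)
      ultimately show ?thesis by (simp add: orthonormal_def)
    qed
    then show ?thesis by (simp add: \<O>_def orthonormal_def)
  qed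
  then obtain E where E: "E \<in> \<O>" and max: "\<And>X. X \<in> \<O> \<Longrightarrow> E \<subseteq> X \<Longrightarrow> X = E"
    using subset_Zorn'[of \<O>] by blast
  define N where "N = closure (complex_vector.span E)"
  have N: "complex_vector.subspace N" "closed N"
    by (simp_all add: N_def closure_complex_subspace complex_vector.subspace_span)
  have EN: "E \<subseteq> N"
    unfolding N_def using closure_subset complex_vector.span_superset by blast
  have "x \<in> N" for x
  proof (rule ccontr)
    assume "x \<notin> N"
    define u where "u = x - orth_proj N x"
    have u0: "u \<noteq> 0"
      using orth_proj_mem[OF N, of x] \<open>x \<notin> N\<close> by (auto simp: u_def)
    have orth: "cinner u e = 0" if "e \<in> N" for e
      unfolding u_def by (rule orth_proj_orthogonal[OF N that])
    define v where "v = complex_of_real (1 / norm u) *\<^sub>C u"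
    have "insert v E \<in> \<O>"
      using orthonormal_insert_normalized[of E u] E u0 orth EN by (auto simp: v_def \<O>_def)
    from max[OF this] have "v \<in> E" by blast
    then have "cinner u v = 0"
      using orth EN by blast
    then show False
      using u0 by (simp add: v_def cinner_scaleC_right norm_eq_cinner)
  qed
  then have "orthonormal_basis E"
    using E by (auto simp: orthonormal_basis_def \<O>_def orthonormal_def N_def)
  then show ?thesis by blast
qed

lemma orthonormal_basis_some_basis: "orthonormal_basis some_basis"
  unfolding some_basis_def using orthonormal_basis_exists by (rule someI_ex)

text \<open>The error of the Fourier sum is orthogonal to the span of \<open>F\<close>, so Pythagoras applies.\<close>

lemma fourier_best_approximation:
  assumes E: "orthonormal F" and F: "finite F" and y: "y = (\<Sum>e\<in>F. r e *\<^sub>C e)"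
  shows "norm (x - (\<Sum>e\<in>F. cinner x e *\<^sub>C e)) \<le> norm (x - y)"
proof -
  define p where "p = (\<Sum>e\<in>F. cinner x e *\<^sub>C e)"
  have pe: "cinner (x - p) e = 0" if "e \<in> F" for e
  proof -
    have "cinner p e = (\<Sum>f\<in>F. cinner x f * cinner f e)"
      by (simp add: p_def cinner.sum_left cinner_scaleC_left)
    also have "\<dots> = (\<Sum>f\<in>F. if f = e then cinner x f else 0)"
      using that E by (intro sum.cong refl) (simp add: orthonormalD)
    also have "\<dots> = cinner x e"
      using F that by simp
    finally show ?thesis by (simp add: cinner.diff_left)
  qed
  have "p - y = (\<Sum>e\<in>F. (cinner x e - r e) *\<^sub>C e)"
    by (simp add: p_def y sum_subtractf complex_vector.scale_left_diff_distrib)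
  then have "cinner (x - p) (p - y) = (\<Sum>e\<in>F. cnj (cinner x e - r e) * cinner (x - p) e)"
    by (simp add: cinner.sum_right cinner_scaleC_right)
  also have "\<dots> = 0"
    using pe by simp
  finally have "inner (x - p) (p - y) = 0"
    by (simp add: inner_eq_Re_cinner)
  then have "inner (p - y) (x - p) = 0"
    by (subst inner_commute)
  moreover have "(norm (b + a))\<^sup>2 = (norm b)\<^sup>2 + (norm a)\<^sup>2" if "inner a b = 0" for a b :: 'a
    using that by (simp add: power2_norm_eq_inner inner_add_left inner_add_right inner_commute[of b a])
  ultimately have "(norm ((x - p) + (p - y)))\<^sup>2 = (norm (x - p))\<^sup>2 + (norm (p - y))\<^sup>2"
    by (simp only:)
  then have "(norm (x - p))\<^sup>2 \<le> (norm (x - y))\<^sup>2"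
    by simp
  then show ?thesis
    unfolding p_def by (rule power2_le_imp_le) simp
qed

text \<open>Elements of the span of the basis come close to \<open>x\<close>, and Fourier sums over larger finite sets
  are at least as close.\<close>

lemma fourier_has_sum:
  assumes E: "orthonormal_basis E"
  shows "((\<lambda>e. cinner x e *\<^sub>C e) has_sum x) E"
  unfolding has_sum_def tendsto_iff
proof (intro allI impI)
  fix \<epsilon> :: real assume \<epsilon>: "0 < \<epsilon>"
  have on: "orthonormal E" using E by (simp add: orthonormal_basis_def orthonormal_def)
  have "x \<in> closure (complex_vector.span E)" using E by (simp add: orthonormal_basis_def)
  then obtain y where "y \<in> complex_vector.span E" and y: "dist y x < \<epsilon>"
    using \<epsilon> closure_approachable by blast
  then obtain t r where t: "finite t" "t \<subseteq> E" and yr: "y = (\<Sum>e\<in>t. r e *\<^sub>C e)"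
    unfolding complex_vector.span_explicit by blast
  have "dist (\<Sum>e\<in>F. cinner x e *\<^sub>C e) x < \<epsilon>" if F: "finite F" "t \<subseteq> F" "F \<subseteq> E" for F
  proof -
    have "y = (\<Sum>e\<in>F. (if e \<in> t then r e else 0) *\<^sub>C e)"
      unfolding yr using F by (intro sum.mono_neutral_cong_left) auto
    moreover have "orthonormal F"
      using on F unfolding orthonormal_def by blast
    ultimately have "norm (x - (\<Sum>e\<in>F. cinner x e *\<^sub>C e)) \<le> norm (x - y)"
      by (intro fourier_best_approximation[OF _ F(1)])
    then show ?thesis
      using y by (simp add: dist_norm norm_minus_commute)
  qed
  then show "\<forall>\<^sub>F F in finite_subsets_at_top E. dist (\<Sum>e\<in>F. cinner x e *\<^sub>C e) x < \<epsilon>"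
    unfolding eventually_finite_subsets_at_top using t by blast
qed

lemma parseval_has_sum:
  assumes E: "orthonormal_basis E"
  shows "((\<lambda>e. cinner x e * cinner e y) has_sum cinner x y) E"
  using has_sum_bounded_linear[OF cinner.bounded_linear_left fourier_has_sum[OF E, of x], of y]
  by (simp add: cinner_scaleC_left)

lemma ennreal_summable_on [simp]: "(f :: _ \<Rightarrow> ennreal) summable_on A"
  by (rule nonneg_summable_on_complete) simp

lemma parseval_ennreal:
  assumes E: "orthonormal_basis E"
  shows "(\<Sum>\<^sub>\<infinity>e\<in>E. ennreal ((cmod (cinner x e))\<^sup>2)) = ennreal ((norm x)\<^sup>2)"
proof -
  have "cinner x e * cinner e x = complex_of_real ((cmod (cinner x e))\<^sup>2)" for e
    unfolding complex_norm_square by (subst (2) cinner_commute) (rule refl)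
  with parseval_has_sum[OF E, of x x]
  have "((\<lambda>e. complex_of_real ((cmod (cinner x e))\<^sup>2)) has_sum complex_of_real ((norm x)\<^sup>2)) E"
    by (simp add: norm_eq_cinner)
  from has_sum_bounded_linear[OF bounded_linear_Re this]
  have "((\<lambda>e. (cmod (cinner x e))\<^sup>2) has_sum (norm x)\<^sup>2) E"
    by simp
  moreover have "sum (\<lambda>e. ennreal ((cmod (cinner x e))\<^sup>2)) = (\<lambda>F. ennreal (\<Sum>e\<in>F. (cmod (cinner x e))\<^sup>2))"
    by (rule ext) (simp add: sum_ennreal)
  ultimately have "((\<lambda>e. ennreal ((cmod (cinner x e))\<^sup>2)) has_sum ennreal ((norm x)\<^sup>2)) E"
    unfolding has_sum_def by (simp add: tendsto_ennrealI)
  then show ?thesis by (rule infsumI)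
qed

lemma infsum_ennreal_SUP:
  "(\<Sum>\<^sub>\<infinity>x\<in>A. f x) = (SUP F\<in>{F. finite F \<and> F \<subseteq> A}. sum f F)" for f :: "_ \<Rightarrow> ennreal"
  by (rule nonneg_infsum_complete) simp

lemma infsum_sum_ennreal:
  fixes f :: "'b \<Rightarrow> 'c \<Rightarrow> ennreal"
  assumes "finite F"
  shows "(\<Sum>x\<in>F. \<Sum>\<^sub>\<infinity>y\<in>B. f x y) = (\<Sum>\<^sub>\<infinity>y\<in>B. \<Sum>x\<in>F. f x y)"
  using assms by induction (simp_all add: infsum_add)

text \<open>An infinite sum is the supremum of its finite partial sums, and a finite sum may be moved inside an
  infinite one. By symmetry, this inequality gives equality.\<close>

lemma infsum_swap_ennreal_le:
  fixes f :: "'b \<Rightarrow> 'c \<Rightarrow> ennreal"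
  shows "(\<Sum>\<^sub>\<infinity>x\<in>A. \<Sum>\<^sub>\<infinity>y\<in>B. f x y) \<le> (\<Sum>\<^sub>\<infinity>y\<in>B. \<Sum>\<^sub>\<infinity>x\<in>A. f x y)"
  unfolding infsum_ennreal_SUP[of "\<lambda>x. \<Sum>\<^sub>\<infinity>y\<in>B. f x y"]
proof (rule SUP_least)
  fix F assume F: "F \<in> {F. finite F \<and> F \<subseteq> A}"
  then have "(\<Sum>x\<in>F. \<Sum>\<^sub>\<infinity>y\<in>B. f x y) = (\<Sum>\<^sub>\<infinity>y\<in>B. \<Sum>x\<in>F. f x y)"
    by (simp add: infsum_sum_ennreal)
  also have "\<dots> \<le> (\<Sum>\<^sub>\<infinity>y\<in>B. \<Sum>\<^sub>\<infinity>x\<in>A. f x y)"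
  proof (rule infsum_mono)
    show "(\<Sum>x\<in>F. f x y) \<le> (\<Sum>\<^sub>\<infinity>x\<in>A. f x y)" for y
      unfolding infsum_ennreal_SUP using F by (intro SUP_upper)
  qed simp_all
  finally show "(\<Sum>x\<in>F. \<Sum>\<^sub>\<infinity>y\<in>B. f x y) \<le> (\<Sum>\<^sub>\<infinity>y\<in>B. \<Sum>\<^sub>\<infinity>x\<in>A. f x y)" .
qed

lemma infsum_swap_ennreal:
  fixes f :: "'b \<Rightarrow> 'c \<Rightarrow> ennreal"
  shows "(\<Sum>\<^sub>\<infinity>x\<in>A. \<Sum>\<^sub>\<infinity>y\<in>B. f x y) = (\<Sum>\<^sub>\<infinity>y\<in>B. \<Sum>\<^sub>\<infinity>x\<in>A. f x y)"
  by (intro antisym infsum_swap_ennreal_le)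

lemma infsum_cmult_ennreal:
  fixes f :: "'b \<Rightarrow> ennreal"
  shows "(\<Sum>\<^sub>\<infinity>x\<in>A. c * f x) = c * (\<Sum>\<^sub>\<infinity>x\<in>A. f x)"
  unfolding infsum_ennreal_SUP SUP_mult_left_ennreal by (simp add: sum_distrib_left)

section \<open>Positive operators, square roots and factorization\<close>

lemma positive_operatorD:
  assumes "positive_operator T"
  shows positive_operator_bounded: "T \<in> bounded_operators"
    and positive_operator_nonneg: "0 \<le> Re (cinner (T x) x)"
    and positive_operator_real: "cinner (T x) x = complex_of_real (Re (cinner (T x) x))"
  using assms by (auto simp: positive_operator_def complex_nonneg_Reals_iff complex_eq_iff)

text \<open>Polarisation: the imaginary part of \<open>cinner (T z) z\<close> vanishes for \<open>z = x + y\<close> and for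
  \<open>z = x + \<i> y\<close>.\<close>

lemma positive_operator_self_adjoint:
  assumes T: "positive_operator T"
  shows "cinner (T x) y = cinner x (T y)"
proof -
  note Tb = bounded_operatorsD[OF positive_operator_bounded[OF T]]
  have Im: "Im (cinner (T z) z) = 0" for z
    using T by (auto simp: positive_operator_def complex_nonneg_Reals_iff)
  have 1: "Im (cinner (T x) y) + Im (cinner (T y) x) = 0"
    using Im[of "x + y"] Im[of x] Im[of y] by (simp add: Tb cinner_add_left cinner_add_right)
  have 2: "Re (cinner (T y) x) = Re (cinner (T x) y)"
    using Im[of "x + \<i> *\<^sub>C y"] Im[of x] Im[of y]
    by (simp add: Tb cinner_add_left cinner_add_right cinner_scaleC_left cinner_scaleC_right)
  have "cinner (T x) y = cnj (cinner (T y) x)"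
    using 1 2 by (simp add: complex_eq_iff)
  then show ?thesis
    by (simp add: cinner_commute[of x])
qed

lemma positive_operator_adj: "positive_operator T \<Longrightarrow> adj T = T"
  by (rule adj_eqI) (rule positive_operator_self_adjoint)

text \<open>The form \<open>cinner (T x) y\<close> is a positive semidefinite inner product. Evaluating it at
  \<open>x - t z y\<close> with \<open>z = cinner (T x) y\<close> gives a nonnegative quadratic polynomial in the real
  variable \<open>t\<close>.\<close>

lemma positive_operator_cauchy_schwarz:
  assumes T: "positive_operator T"
  shows "(cmod (cinner (T x) y))\<^sup>2 \<le> Re (cinner (T x) x) * Re (cinner (T y) y)"
proof -
  note Tb = bounded_operatorsD[OF positive_operator_bounded[OF T]]
  define a b z where "a = Re (cinner (T x) x)" and "b = Re (cinner (T y) y)" and "z = cinner (T x) y"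
  have a: "0 \<le> a" and b: "0 \<le> b"
    using positive_operator_nonneg[OF T] by (simp_all add: a_def b_def)
  have zc: "cinner (T y) x = cnj z"
    unfolding z_def positive_operator_self_adjoint[OF T, of y x] by (rule cinner_commute)
  have q: "0 \<le> a - 2 * t * (cmod z)\<^sup>2 + t\<^sup>2 * (cmod z)\<^sup>2 * b" for t
  proof -
    define c where "c = complex_of_real t * z"
    have cz: "cnj c * z = complex_of_real (t * (cmod z)\<^sup>2)" "c * cnj z = complex_of_real (t * (cmod z)\<^sup>2)"
      unfolding of_real_mult complex_norm_square c_def by (simp_all add: ac_simps)
    have "cinner (T (x - c *\<^sub>C y)) (x - c *\<^sub>C y)
        = cinner (T x) x - cnj c * z - c * cnj z + (c * cnj c) * cinner (T y) y"
      by (simp add: Tb cinner.diff_left cinner.diff_right cinner_scaleC_left cinner_scaleC_right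
          z_def[symmetric] zc algebra_simps)
    also have "c * cnj c = complex_of_real (t\<^sup>2 * (cmod z)\<^sup>2)"
      unfolding complex_norm_square[symmetric] by (simp add: c_def norm_mult power_mult_distrib)
    finally have "Re (cinner (T (x - c *\<^sub>C y)) (x - c *\<^sub>C y))
        = a - 2 * t * (cmod z)\<^sup>2 + t\<^sup>2 * (cmod z)\<^sup>2 * b"
      unfolding cz by (simp only: a_def b_def minus_complex.sel plus_complex.sel Re_complex_of_real
          times_complex.sel Im_complex_of_real)
    then show ?thesis
      using positive_operator_nonneg[OF T] by metis
  qed
  have "(cmod z)\<^sup>2 \<le> a * b"
  proof (cases "b = 0")
    case True
    have "z = 0"
    proof (rule ccontr)
      assume z: "z \<noteq> 0"
      then have "2 * ((a + 1) / (2 * (cmod z)\<^sup>2)) * (cmod z)\<^sup>2 = a + 1"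
        by simp
      then show False
        using q[of "(a + 1) / (2 * (cmod z)\<^sup>2)"] True by simp
    qed
    then show ?thesis using True by simp
  next
    case False
    have "(1 / b)\<^sup>2 * (cmod z)\<^sup>2 * b = (1 / b) * (cmod z)\<^sup>2"
      using False by (simp add: power2_eq_square)
    then have "0 \<le> a - (cmod z)\<^sup>2 / b"
      using q[of "1 / b"] by simp
    then show ?thesis
      using False b by (simp add: pos_divide_le_eq)
  qed
  then show ?thesis by (simp add: a_def b_def z_def)
qed

lemma positive_operator_null:
  assumes "positive_operator T" "Re (cinner (T x) x) = 0"
  shows "T x = 0"
  using positive_operator_cauchy_schwarz[OF assms(1), of x "T x"] assms(2)
  by (simp add: norm_eq_cinner)

text \<open>Apply the Cauchy--Schwarz inequality for the form of \<open>T\<close> to \<open>x\<close> and \<open>T x\<close>.\<close>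

lemma positive_operator_contraction:
  assumes T: "positive_operator T" and le: "\<And>x. Re (cinner (T x) x) \<le> (norm x)\<^sup>2"
  shows "norm (T x) \<le> norm x"
proof -
  have "((norm (T x))\<^sup>2)\<^sup>2 = (cmod (cinner (T x) (T x)))\<^sup>2"
    by (simp only: cmod_cinner_self)
  also have "\<dots> \<le> Re (cinner (T x) x) * Re (cinner (T (T x)) (T x))"
    by (rule positive_operator_cauchy_schwarz[OF T])
  also have "\<dots> \<le> (norm x)\<^sup>2 * (norm (T x))\<^sup>2"
    by (intro mult_mono le positive_operator_nonneg[OF T]) simp
  finally have le: "(norm (T x))\<^sup>2 * (norm (T x))\<^sup>2 \<le> (norm x)\<^sup>2 * (norm (T x))\<^sup>2"
    by (simp only: power2_eq_square[of "(norm (T x))\<^sup>2"])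
  show ?thesis
  proof (cases "T x = 0")
    case False
    then have "0 < (norm (T x))\<^sup>2" by simp
    with le have "(norm (T x))\<^sup>2 \<le> (norm x)\<^sup>2" by (rule mult_right_le_imp_le)
    then show ?thesis by (rule power2_le_imp_le) simp
  qed simp
qed

text \<open>Fixed-point iteration for \<open>L = (B + L\<^sup>2) / 2\<close>, which is equivalent to \<open>(1 - L)\<^sup>2 = 1 - B\<close>.\<close>

primrec sqrt_iter :: "('a::complex_hilbert_space \<Rightarrow> 'a) \<Rightarrow> nat \<Rightarrow> 'a \<Rightarrow> 'a" where
  "sqrt_iter B 0 = (\<lambda>x. 0)"
| "sqrt_iter B (Suc n) = (\<lambda>x. (1/2) *\<^sub>C (B x + sqrt_iter B n (sqrt_iter B n x)))"

text \<open>The same iteration for the scalar \<open>B = 1\<close>. It dominates the operator iteration in norm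
  when \<open>B\<close> is a contraction.\<close>

primrec sqrt_majorant :: "nat \<Rightarrow> real" where
  "sqrt_majorant 0 = 0"
| "sqrt_majorant (Suc n) = (1 + (sqrt_majorant n)\<^sup>2) / 2"

lemma sqrt_majorant_bounds: "0 \<le> sqrt_majorant n \<and> sqrt_majorant n \<le> 1"
proof (induction n)
  case (Suc n)
  then have "(sqrt_majorant n)\<^sup>2 \<le> 1"
    by (simp add: power_le_one)
  then show ?case by simp
qed simp

lemma sqrt_majorant_Suc: "sqrt_majorant n \<le> sqrt_majorant (Suc n)"
proof -
  have "0 \<le> (1 - sqrt_majorant n)\<^sup>2" by simp
  then show ?thesis by (simp add: power2_diff)
qed

lemma sqrt_majorant_Cauchy: "Cauchy sqrt_majorant"
proof -
  have "incseq sqrt_majorant"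
    by (rule incseq_SucI) (rule sqrt_majorant_Suc)
  then have "convergent sqrt_majorant"
    using sqrt_majorant_bounds by (auto intro: incseq_convergent[of _ 1] simp: convergent_def)
  then show ?thesis by (rule convergent_Cauchy)
qed

lemma bounded_operators_sqrt_iter:
  "B \<in> bounded_operators \<Longrightarrow> sqrt_iter B n \<in> bounded_operators"
proof (induction n)
  case (Suc n)
  then show ?case
    using bounded_operators_scale[OF bounded_operators_plus[OF Suc.prems
        bounded_operators_comp[OF Suc.IH Suc.IH]], of "1/2"]
    by simp
qed (simp add: bounded_operators_zero_op)

lemma sqrt_iter_self_adjoint:
  assumes "\<And>x y. cinner (B x) y = cinner x (B y)"
  shows "cinner (sqrt_iter B n x) y = cinner x (sqrt_iter B n y)"
  by (induction n arbitrary: x y)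
    (simp_all add: cinner.zero_left cinner.zero_right cinner_scaleC_left cinner_scaleC_right
      cinner_add_left cinner_add_right assms)

lemma sqrt_iter_norm_le:
  assumes B: "\<And>x. norm (B x) \<le> norm x"
  shows "norm (sqrt_iter B n x) \<le> sqrt_majorant n * norm x"
proof (induction n arbitrary: x)
  case (Suc n)
  have "norm (sqrt_iter B n (sqrt_iter B n x)) \<le> sqrt_majorant n * norm (sqrt_iter B n x)"
    by (rule Suc)
  also have "\<dots> \<le> sqrt_majorant n * (sqrt_majorant n * norm x)"
    by (intro mult_left_mono Suc) (simp add: sqrt_majorant_bounds)
  finally have le: "norm (B x + sqrt_iter B n (sqrt_iter B n x)) \<le> norm x + (sqrt_majorant n)\<^sup>2 * norm x"
    using norm_triangle_ineq[of "B x" "sqrt_iter B n (sqrt_iter B n x)"] B[of x]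
    by (simp add: power2_eq_square mult.assoc)
  have N: "norm (sqrt_iter B (Suc n) x) = norm (B x + sqrt_iter B n (sqrt_iter B n x)) / 2"
    unfolding sqrt_iter.simps norm_scaleC by (simp add: norm_divide)
  have M: "sqrt_majorant (Suc n) * norm x = (norm x + (sqrt_majorant n)\<^sup>2 * norm x) / 2"
    by (simp add: distrib_right)
  show ?case
    unfolding N M by (rule divide_right_mono[OF le]) simp
qed simp

text \<open>For two consecutive iterates \<open>Y\<^sub>0\<close>, \<open>Y\<^sub>1\<close> with majorants \<open>y\<^sub>0\<close>, \<open>y\<^sub>1\<close>, twice the next increment is
  \<open>Y\<^sub>1\<^sup>2 - Y\<^sub>0\<^sup>2 = Y\<^sub>1 (Y\<^sub>1 - Y\<^sub>0) + (Y\<^sub>1 - Y\<^sub>0) Y\<^sub>0\<close>, of norm at most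
  \<open>y\<^sub>1 (y\<^sub>1 - y\<^sub>0) + (y\<^sub>1 - y\<^sub>0) y\<^sub>0 = y\<^sub>1\<^sup>2 - y\<^sub>0\<^sup>2\<close>, which is twice the next increment of the majorants.\<close>

lemma sqrt_iter_step:
  assumes Bb: "B \<in> bounded_operators" and B: "\<And>x. norm (B x) \<le> norm x"
  shows "norm (sqrt_iter B (Suc n) x - sqrt_iter B n x) \<le> (sqrt_majorant (Suc n) - sqrt_majorant n) * norm x"
proof (induction n arbitrary: x)
  case 0
  then show ?case
    using B[of x] by (simp add: norm_scaleC norm_divide)
next
  case (Suc n)
  define Y0 Y1 y0 y1 where "Y0 = sqrt_iter B n" and "Y1 = sqrt_iter B (Suc n)"
    and "y0 = sqrt_majorant n" and "y1 = sqrt_majorant (Suc n)"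
  have y: "0 \<le> y0" "0 \<le> y1" "y0 \<le> y1"
    using sqrt_majorant_bounds sqrt_majorant_Suc unfolding y0_def y1_def by blast+
  have IH: "norm (Y1 u - Y0 u) \<le> (y1 - y0) * norm u" for u
    using Suc unfolding Y0_def Y1_def y0_def y1_def .
  have Y0: "norm (Y0 u) \<le> y0 * norm u" and Y1: "norm (Y1 u) \<le> y1 * norm u" for u
    unfolding Y0_def Y1_def y0_def y1_def by (intro sqrt_iter_norm_le B)+
  have Y1b: "Y1 \<in> bounded_operators"
    unfolding Y1_def by (rule bounded_operators_sqrt_iter[OF Bb])
  have "sqrt_iter B (Suc (Suc n)) x - sqrt_iter B (Suc n) x
      = (1/2) *\<^sub>C ((B x + Y1 (Y1 x)) - (B x + Y0 (Y0 x)))"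
    unfolding sqrt_iter.simps(2)[of B "Suc n"] Y1_def[symmetric]
    unfolding Y1_def sqrt_iter.simps(2)[of B n] Y0_def[symmetric]
    by (simp only: complex_vector.scale_right_diff_distrib)
  also have "(B x + Y1 (Y1 x)) - (B x + Y0 (Y0 x)) = Y1 (Y1 x - Y0 x) + (Y1 (Y0 x) - Y0 (Y0 x))"
    by (simp add: bounded_operators_diff[OF Y1b])
  finally have "norm (sqrt_iter B (Suc (Suc n)) x - sqrt_iter B (Suc n) x)
      = (1/2) * norm (Y1 (Y1 x - Y0 x) + (Y1 (Y0 x) - Y0 (Y0 x)))"
    by (simp add: norm_scaleC norm_divide)
  also have "\<dots> \<le> (1/2) * (y1 * ((y1 - y0) * norm x) + (y1 - y0) * (y0 * norm x))"
  proof (intro mult_left_mono order_trans[OF norm_triangle_ineq] add_mono)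
    show "norm (Y1 (Y1 x - Y0 x)) \<le> y1 * ((y1 - y0) * norm x)"
      by (rule order_trans[OF Y1]) (intro mult_left_mono IH y)
    show "norm (Y1 (Y0 x) - Y0 (Y0 x)) \<le> (y1 - y0) * (y0 * norm x)"
      by (rule order_trans[OF IH]) (use y in \<open>intro mult_left_mono Y0, simp\<close>)
  qed simp
  also have "\<dots> = (sqrt_majorant (Suc (Suc n)) - sqrt_majorant (Suc n)) * norm x"
    unfolding sqrt_majorant.simps(2)[of "Suc n"] y1_def[symmetric]
    unfolding y1_def sqrt_majorant.simps(2)[of n] y0_def[symmetric]
    by (simp add: field_simps power2_eq_square)
  finally show ?case .
qed

lemma sqrt_iter_diff:
  assumes Bb: "B \<in> bounded_operators" and B: "\<And>x. norm (B x) \<le> norm x" and "n \<le> m"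
  shows "norm (sqrt_iter B m x - sqrt_iter B n x) \<le> (sqrt_majorant m - sqrt_majorant n) * norm x"
  using \<open>n \<le> m\<close>
proof (induction m rule: dec_induct)
  case (step m)
  have "norm (sqrt_iter B (Suc m) x - sqrt_iter B n x)
      \<le> norm (sqrt_iter B (Suc m) x - sqrt_iter B m x) + norm (sqrt_iter B m x - sqrt_iter B n x)"
    by (rule order_trans[OF _ norm_triangle_ineq]) simp
  also have "\<dots> \<le> (sqrt_majorant (Suc m) - sqrt_majorant m) * norm x
      + (sqrt_majorant m - sqrt_majorant n) * norm x"
    by (intro add_mono sqrt_iter_step[OF Bb B] step.IH)
  also have "\<dots> = (sqrt_majorant (Suc m) - sqrt_majorant n) * norm x"
    by (simp only: distrib_right[symmetric]) simp
  finally show ?case .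
qed simp

lemma sqrt_iter_commute:
  assumes C: "C \<in> bounded_operators" and CB: "\<And>x. C (B x) = B (C x)"
  shows "C (sqrt_iter B n x) = sqrt_iter B n (C x)"
  by (induction n arbitrary: x)
    (simp_all add: bounded_operatorsD[OF C] CB)

text \<open>The majorants increase and are bounded, hence Cauchy; so the iterates converge, and all listed
  properties pass to the limit. The commutation property is what later yields uniqueness of square
  roots.\<close>

lemma sqrt_iter_limit:
  assumes Bb: "B \<in> bounded_operators" and Bs: "\<And>x y. cinner (B x) y = cinner x (B y)"
    and B: "\<And>x. norm (B x) \<le> norm x"
  obtains L where "L \<in> bounded_operators" "\<And>x y. cinner (L x) y = cinner x (L y)"
    "\<And>x. norm (L x) \<le> norm x" "\<And>x. L x + L x = B x + L (L x)"
    "\<forall>C\<in>bounded_operators. C \<circ> B = B \<circ> C \<longrightarrow> C \<circ> L = L \<circ> C"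
proof -
  let ?Y = "sqrt_iter B"
  note Yb = bounded_operators_sqrt_iter[OF Bb]
  have "Cauchy (\<lambda>n. ?Y n x)" for x
  proof (rule metric_CauchyI)
    fix e :: real assume e: "0 < e"
    have "0 < e / (norm x + 1)"
      using e by (simp add: add_nonneg_pos)
    then obtain N where N: "\<And>m n. m \<ge> N \<Longrightarrow> n \<ge> N \<Longrightarrow> dist (sqrt_majorant m) (sqrt_majorant n) < e / (norm x + 1)"
      using sqrt_majorant_Cauchy unfolding Cauchy_def by blast
    have *: "dist (?Y m x) (?Y n x) < e" if "N \<le> n" "n \<le> m" for m n
    proof -
      have "dist (?Y m x) (?Y n x) \<le> (sqrt_majorant m - sqrt_majorant n) * norm x"
        unfolding dist_norm by (rule sqrt_iter_diff[OF Bb B that(2)])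
      also have "\<dots> \<le> (e / (norm x + 1)) * norm x"
        using N[of m n] that by (intro mult_right_mono) (auto simp: dist_real_def)
      also have "\<dots> < e"
        using e by (simp add: divide_less_eq add_nonneg_pos)
      finally show ?thesis .
    qed
    have "dist (?Y m x) (?Y n x) < e" if "N \<le> m" "N \<le> n" for m n
      using *[of n m] *[of m n] that by (cases "n \<le> m") (auto simp: dist_commute)
    then show "\<exists>N. \<forall>m\<ge>N. \<forall>n\<ge>N. dist (?Y m x) (?Y n x) < e"
      by blast
  qed
  then have "\<exists>l. (\<lambda>n. ?Y n x) \<longlonglongrightarrow> l" for x
    using Cauchy_convergent convergent_def by metis
  then obtain L where L: "\<And>x. (\<lambda>n. ?Y n x) \<longlonglongrightarrow> L x"
    by metis
  have norm_Y: "norm (?Y n x) \<le> norm x" for n x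
  proof -
    have "norm (?Y n x) \<le> sqrt_majorant n * norm x" by (rule sqrt_iter_norm_le[OF B])
    also have "\<dots> \<le> 1 * norm x" by (intro mult_right_mono) (simp_all add: sqrt_majorant_bounds)
    finally show ?thesis by simp
  qed
  have norm_L: "norm (L x) \<le> norm x" for x
    by (rule LIMSEQ_le_const2[OF tendsto_norm[OF L]]) (use norm_Y in blast)
  have Lb: "L \<in> bounded_operators"
  proof (rule bounded_operatorsI[of _ 1])
    show "L (x + y) = L x + L y" for x y
    proof (rule LIMSEQ_unique[OF L])
      show "(\<lambda>n. ?Y n (x + y)) \<longlonglongrightarrow> L x + L y"
        unfolding bounded_operators_add[OF Yb] by (intro tendsto_add L)
    qed
    show "L (c *\<^sub>C x) = c *\<^sub>C L x" for c x
    proof (rule LIMSEQ_unique[OF L])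
      show "(\<lambda>n. ?Y n (c *\<^sub>C x)) \<longlonglongrightarrow> c *\<^sub>C L x"
        unfolding bounded_operators_scaleC[OF Yb] by (intro scaleC.tendsto tendsto_const L)
    qed
  qed (simp add: norm_L)
  have Ls: "cinner (L x) y = cinner x (L y)" for x y
  proof (rule LIMSEQ_unique)
    show "(\<lambda>n. cinner (?Y n x) y) \<longlonglongrightarrow> cinner (L x) y"
      by (intro cinner.tendsto tendsto_const L)
    show "(\<lambda>n. cinner (?Y n x) y) \<longlonglongrightarrow> cinner x (L y)"
      unfolding sqrt_iter_self_adjoint[OF Bs] by (intro cinner.tendsto tendsto_const L)
  qed
  have LC: "C (L x) = L (C x)" if C: "C \<in> bounded_operators" "C \<circ> B = B \<circ> C" for C x
  proof (rule LIMSEQ_unique)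
    show "(\<lambda>n. C (?Y n x)) \<longlonglongrightarrow> C (L x)"
      by (rule bounded_linear.tendsto[OF bounded_operators_linear[OF C(1)] L])
    show "(\<lambda>n. C (?Y n x)) \<longlonglongrightarrow> L (C x)"
      using sqrt_iter_commute[OF C(1), of B] C(2) L[of "C x"] by (simp add: fun_eq_iff)
  qed
  have YY: "(\<lambda>n. ?Y n (?Y n x)) \<longlonglongrightarrow> L (L x)" for x
  proof -
    have "(\<lambda>n. ?Y n (?Y n x - L x)) \<longlonglongrightarrow> 0"
    \<comment> \<open>The iterates are contractions, so they may be applied to a null sequence.\<close>
    proof (rule Lim_null_comparison)
      show "(\<lambda>n. norm (?Y n x - L x)) \<longlonglongrightarrow> 0"
        using L[of x] by (intro tendsto_norm_zero LIM_zero)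
    qed (simp add: norm_Y)
    from tendsto_add[OF this L[of "L x"]] show ?thesis
      by (simp add: bounded_operators_diff[OF Yb])
  qed
  have LL: "L x + L x = B x + L (L x)" for x
  proof -
    have "(\<lambda>n. ?Y (Suc n) x) \<longlonglongrightarrow> (1/2) *\<^sub>C (B x + L (L x))"
      unfolding sqrt_iter.simps by (intro scaleC.tendsto tendsto_add tendsto_const YY)
    then have "L x = (1/2) *\<^sub>C (B x + L (L x))"
      using LIMSEQ_Suc[OF L[of x]] LIMSEQ_unique by blast
    then have "L x + L x = (1/2 + 1/2) *\<^sub>C (B x + L (L x))"
      unfolding scaleC_add_left by simp
    then show ?thesis by simp
  qed
  show thesis
    by (rule that[OF Lb Ls norm_L LL]) (use LC in \<open>auto simp: fun_eq_iff\<close>)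
qed

text \<open>Scaled by an upper bound \<open>K\<close> for its norm, \<open>A\<close> becomes \<open>1 - B\<close> with \<open>B\<close> a positive
  contraction, and \<open>1 - L\<close> is a square root of \<open>1 - B\<close> for the limit \<open>L\<close> of the iteration.\<close>

lemma positive_sqrt_exists:
  assumes A: "positive_operator A"
  obtains R where "positive_operator R" "R \<circ> R = A"
    "\<forall>C\<in>bounded_operators. C \<circ> A = A \<circ> C \<longrightarrow> C \<circ> R = R \<circ> C"
proof -
  note Ab = positive_operator_bounded[OF A]
  obtain K0 where K0: "\<And>x. norm (A x) \<le> K0 * norm x"
    using bounded_operators_bound[OF Ab] by metis
  define K where "K = max K0 1"
  have K: "0 < K" and KA: "norm (A x) \<le> K * norm x" for x
  proof -
    show "0 < K" by (simp add: K_def)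
    have "K0 * norm x \<le> K * norm x" by (intro mult_right_mono) (simp_all add: K_def)
    then show "norm (A x) \<le> K * norm x" using K0[of x] by linarith
  qed
  define k where "k = complex_of_real (1 / K)"
  define B where "B x = x - k *\<^sub>C A x" for x
  have Bb: "B \<in> bounded_operators"
    unfolding B_def using bounded_operators_minus[OF bounded_operators_id bounded_operators_scale[OF Ab], of k]
    by simp
  have A_le: "Re (cinner (A x) x) / K \<le> (norm x)\<^sup>2" for x
  proof -
    have "Re (cinner (A x) x) \<le> cmod (cinner (A x) x)" by (rule complex_Re_le_cmod)
    also have "\<dots> \<le> norm (A x) * norm x" by (rule cmod_cinner_le)
    also have "\<dots> \<le> (K * norm x) * norm x" by (intro mult_right_mono KA) simp
    finally show ?thesis
      using K by (simp add: pos_divide_le_eq power2_eq_square mult.commute mult.left_commute)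
  qed
  have Bx: "cinner (B x) x = complex_of_real ((norm x)\<^sup>2 - Re (cinner (A x) x) / K)" for x
    using positive_operator_real[OF A, of x]
    by (simp add: B_def cinner.diff_left cinner_scaleC_left norm_eq_cinner k_def)
  have Bp: "positive_operator B"
    unfolding positive_operator_def using Bb A_le by (simp add: Bx complex_nonneg_Reals_iff)
  have B1: "norm (B x) \<le> norm x" for x
  proof (rule positive_operator_contraction[OF Bp])
    show "Re (cinner (B x) x) \<le> (norm x)\<^sup>2" for x
      using positive_operator_nonneg[OF A, of x] K by (simp add: Bx)
  qed
  obtain L where Lb: "L \<in> bounded_operators" and Ls: "\<And>x y. cinner (L x) y = cinner x (L y)"
    and L1: "\<And>x. norm (L x) \<le> norm x" and LL: "\<And>x. L x + L x = B x + L (L x)"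
    and LC: "\<forall>C\<in>bounded_operators. C \<circ> B = B \<circ> C \<longrightarrow> C \<circ> L = L \<circ> C"
    by (rule sqrt_iter_limit[OF Bb positive_operator_self_adjoint[OF Bp] B1]) (rule that)
  define s where "s = complex_of_real (sqrt K)"
  define R where "R x = s *\<^sub>C (x - L x)" for x
  have ss: "s * s = complex_of_real K"
    using K by (simp add: s_def flip: of_real_mult)
  have Rb: "R \<in> bounded_operators"
    unfolding R_def using bounded_operators_scale[OF bounded_operators_minus[OF bounded_operators_id Lb]]
    by simp
  have "cinner (R x) x \<in> \<real>\<^sub>\<ge>\<^sub>0" for x
  proof -
    have "Im (cinner (L x) x) = 0"
      using arg_cong[OF cinner_commute[of "L x" x], of Im] Ls[of x x] by simp
    moreover have "Re (cinner (L x) x) \<le> (norm x)\<^sup>2"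
    proof -
      have "Re (cinner (L x) x) \<le> cmod (cinner (L x) x)" by (rule complex_Re_le_cmod)
      also have "\<dots> \<le> norm (L x) * norm x" by (rule cmod_cinner_le)
      also have "\<dots> \<le> norm x * norm x" by (intro mult_right_mono L1) simp
      finally show ?thesis by (simp add: power2_eq_square)
    qed
    ultimately show ?thesis
      using K by (simp add: R_def s_def cinner_scaleC_left cinner.diff_left norm_eq_cinner
          complex_nonneg_Reals_iff del: of_real_power)
  qed
  then have Rp: "positive_operator R"
    using Rb by (simp add: positive_operator_def)
  have RR: "R \<circ> R = A"
  proof
    fix x
    have "(R \<circ> R) x = (s * s) *\<^sub>C (x - L x - (L x - L (L x)))"
      by (simp add: R_def bounded_operatorsD[OF Lb] scaleC_scaleC
          complex_vector.scale_right_diff_distrib)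
    also have "x - L x - (L x - L (L x)) = x - (L x + L x) + L (L x)"
      by (simp add: algebra_simps)
    also have "\<dots> = k *\<^sub>C A x"
      unfolding LL by (simp add: B_def)
    finally show "(R \<circ> R) x = A x"
      using K unfolding ss by (simp add: k_def scaleC_scaleC)
  qed
  have RC: "C \<circ> R = R \<circ> C" if C: "C \<in> bounded_operators" "C \<circ> A = A \<circ> C" for C
  proof -
    have "C \<circ> B = B \<circ> C"
      using C(2) by (simp add: fun_eq_iff B_def bounded_operatorsD[OF C(1)])
    then have "C \<circ> L = L \<circ> C"
      using LC C(1) by blast
    then show ?thesis
      by (simp add: fun_eq_iff R_def bounded_operatorsD[OF C(1)])
  qed
  show thesis
    by (rule that[OF Rp RR]) (use RC in blast)
qed

text \<open>Compare any positive root \<open>S\<close> with the constructed root \<open>R\<close>, which commutes with it. For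
  \<open>y = (R - S) x\<close> one has \<open>(R + S) y = (R\<^sup>2 - S\<^sup>2) x = 0\<close>. Since both \<open>R\<close> and \<open>S\<close> are positive, this
  forces \<open>R y = S y = 0\<close>, and then \<open>\<parallel>y\<parallel>\<^sup>2 = \<langle>y, (R - S) x\<rangle> = 0\<close>.\<close>

lemma positive_sqrt_unique:
  assumes A: "positive_operator A" and S: "positive_operator S" "S \<circ> S = A"
    and T: "positive_operator T" "T \<circ> T = A"
  shows "S = T"
proof -
  obtain R where R: "positive_operator R" "R \<circ> R = A"
    and RC: "\<forall>C\<in>bounded_operators. C \<circ> A = A \<circ> C \<longrightarrow> C \<circ> R = R \<circ> C"
    by (rule positive_sqrt_exists[OF A]) (rule that)
  have "S = R" if S: "positive_operator S" "S \<circ> S = A" for S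
  proof
    fix x
    note Rb = bounded_operatorsD[OF positive_operator_bounded[OF R(1)]]
    note Sb = bounded_operatorsD[OF positive_operator_bounded[OF S(1)]]
    have A1: "S (S x) = A x" "R (R x) = A x" for x
      using S(2) R(2) by (auto simp: fun_eq_iff)
    have "S \<circ> A = A \<circ> S"
      unfolding S(2)[symmetric] by (rule comp_assoc[symmetric])
    then have SR: "S (R x) = R (S x)" for x
      using RC positive_operator_bounded[OF S(1)] by (auto simp: fun_eq_iff)
    define y where "y = R x - S x"
    have "R y + S y = 0"
      by (simp add: y_def Rb Sb A1 SR)
    then have "Re (cinner (R y) y) + Re (cinner (S y) y) = 0"
      by (metis cinner_add_left cinner.zero_left plus_complex.sel(1) zero_complex.sel(1))
    then have "Re (cinner (R y) y) = 0" "Re (cinner (S y) y) = 0"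
      using positive_operator_nonneg[OF R(1), of y] positive_operator_nonneg[OF S(1), of y] by linarith+
    then have "R y = 0" "S y = 0"
      using positive_operator_null R(1) S(1) by blast+
    then have "cinner y y = 0"
      using positive_operator_self_adjoint[OF R(1), of y x] positive_operator_self_adjoint[OF S(1), of y x]
      unfolding y_def[THEN arg_cong[of _ _ "cinner y"]]
      by (simp add: cinner.diff_right cinner.zero_left)
    then show "S x = R x"
      by (simp add: norm_eq_cinner y_def)
  qed
  from this[OF S] this[OF T] show ?thesis by simp
qed

lemma positive_operator_adj_comp:
  assumes T: "T \<in> bounded_operators"
  shows "positive_operator (adj T \<circ> T)"
  unfolding positive_operator_def
  using T by (simp add: bounded_operators_comp bounded_operators_adj cinner_adj_left norm_eq_cinner
      complex_nonneg_Reals_iff del: of_real_power)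

lemma abs_operator:
  assumes T: "T \<in> bounded_operators"
  shows positive_abs_operator: "positive_operator (abs_operator T)"
    and abs_operator_square: "abs_operator T \<circ> abs_operator T = adj T \<circ> T"
proof -
  note P = positive_operator_adj_comp[OF T]
  obtain R where R: "positive_operator R" "R \<circ> R = adj T \<circ> T"
    by (rule positive_sqrt_exists[OF P]) (rule that)
  have "abs_operator T = R"
    unfolding abs_operator_def
    using R positive_sqrt_unique[OF P] by (intro the_equality) blast+
  with R show "positive_operator (abs_operator T)" "abs_operator T \<circ> abs_operator T = adj T \<circ> T"
    by simp_all
qed

lemma norm_abs_operator:
  assumes T: "T \<in> bounded_operators"
  shows "norm (abs_operator T x) = norm (T x)"
proof -
  note P = abs_operator[OF T]
  have "cinner (abs_operator T x) (abs_operator T x) = cinner (T x) (T x)"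
    using P(2) by (simp add: positive_operator_self_adjoint[OF P(1), of x] cinner_adj_right[OF T]
        fun_eq_iff)
  then have "(norm (abs_operator T x))\<^sup>2 = (norm (T x))\<^sup>2"
    by (simp only: cmod_cinner_self[symmetric])
  then show ?thesis
    by (simp add: power2_eq_iff_nonneg)
qed

text \<open>Polar decomposition without the partial isometry. For each \<open>y\<close> the functional
  \<open>S x \<mapsto> cinner (T x) y\<close> is well defined and bounded on the range of \<open>S\<close>. The vector \<open>W y\<close>
  representing it in the closure of this range is unique, so \<open>W\<close> is linear, and its adjoint is the
  factor.\<close>

lemma douglas_factorization:
  assumes T: "T \<in> bounded_operators" and S: "S \<in> bounded_operators"
    and le: "\<And>x. norm (T x) \<le> norm (S x)"
  obtains U where "U \<in> bounded_operators" "T = U \<circ> S"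
proof -
  note Tb = bounded_operatorsD[OF T] and Sb = bounded_operatorsD[OF S]
  have rangeM: "complex_vector.subspace (range S)"
    unfolding complex_vector.subspace_def
    by (auto simp flip: Sb(2,4) intro: range_eqI[of _ S 0, OF Sb(5)[symmetric]])
  have ex: "\<exists>m. m \<in> closure (range S) \<and> (\<forall>x. cinner (T x) y = cinner (S x) m)" for y
  proof -
    define g where "g z = cinner (T (SOME x. S x = z)) y" for z
    have gS: "g (S x) = cinner (T x) y" for x
    proof -
      define x' where "x' = (SOME x'. S x' = S x)"
      have "S x' = S x"
        unfolding x'_def by (rule someI_ex) blast
      then have "norm (T (x' - x)) \<le> 0"
        using le[of "x' - x"] by (simp add: Sb)
      then have "T x' = T x" by (simp add: Tb)
      then show ?thesis by (simp add: g_def x'_def)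
    qed
    obtain m where "m \<in> closure (range S)" "\<And>z. z \<in> range S \<Longrightarrow> g z = cinner z m"
    proof (rule riesz_subspace[OF rangeM, of g "norm y"])
      show "g (z + w) = g z + g w" if "z \<in> range S" "w \<in> range S" for z w
        using that by (auto simp: gS Tb cinner_add_left simp flip: Sb(2))
      show "g (c *\<^sub>C z) = c * g z" if "z \<in> range S" for c z
        using that by (auto simp: gS Tb cinner_scaleC_left simp flip: Sb(4))
      show "cmod (g z) \<le> norm y * norm z" if z: "z \<in> range S" for z
      proof -
        obtain x where x: "z = S x" using z by blast
        have "cmod (g z) \<le> norm (T x) * norm y"
          unfolding x gS by (rule cmod_cinner_le)
        also have "\<dots> \<le> norm (S x) * norm y"
          by (intro mult_right_mono le) simp
        finally show ?thesis by (simp add: x mult.commute)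
      qed
    qed blast
    then show ?thesis by (metis gS rangeI)
  qed
  then obtain W where Wc: "\<And>y. W y \<in> closure (range S)"
    and W: "\<And>x y. cinner (T x) y = cinner (S x) (W y)"
    by metis
  have cl: "complex_vector.subspace (closure (range S))"
    by (rule closure_complex_subspace[OF rangeM])
  have uniq: "w = v" if "w \<in> closure (range S)" "v \<in> closure (range S)"
    "\<And>x. cinner (S x) w = cinner (S x) v" for w v
  proof -
    have "cinner (w - v) (S x) = 0" for x
      using that(3)[of x] by (subst cinner_eq_zero_commute) (simp add: cinner.diff_right)
    then have "cinner (w - v) z = 0" if "z \<in> range S" for z
      using that by blast
    moreover have "w - v \<in> closure (range S)"
      using cl that(1,2) by (rule complex_vector.subspace_diff)
    ultimately have "cinner (w - v) (w - v) = 0"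
      by (rule orthogonal_to_closure)
    then show ?thesis by (simp add: norm_eq_cinner)
  qed
  have Wb: "W \<in> bounded_operators"
  proof (rule bounded_operatorsI[of _ 1])
    show "W (x + y) = W x + W y" for x y
    proof (rule uniq[OF Wc complex_vector.subspace_add[OF cl Wc Wc]])
      show "cinner (S z) (W (x + y)) = cinner (S z) (W x + W y)" for z
        unfolding cinner_add_right W[symmetric] ..
    qed
    show "W (c *\<^sub>C x) = c *\<^sub>C W x" for c x
    proof (rule uniq[OF Wc complex_vector.subspace_scale[OF cl Wc]])
      show "cinner (S z) (W (c *\<^sub>C x)) = cinner (S z) (c *\<^sub>C W x)" for z
        unfolding cinner_scaleC_right W[symmetric] ..
    qed
    show "norm (W y) \<le> 1 * norm y" for y
    proof -
      have "closed {z. cmod (cinner z (W y)) \<le> norm z * norm y}"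
        by (intro closed_Collect_le continuous_intros cinner.continuous_on)
      moreover have "cmod (cinner (S x) (W y)) \<le> norm (S x) * norm y" for x
      proof -
        have "cmod (cinner (S x) (W y)) \<le> norm (T x) * norm y"
          unfolding W[symmetric] by (rule cmod_cinner_le)
        also have "\<dots> \<le> norm (S x) * norm y"
          by (intro mult_right_mono le) simp
        finally show ?thesis .
      qed
      ultimately have "closure (range S) \<subseteq> {z. cmod (cinner z (W y)) \<le> norm z * norm y}"
        by (intro closure_minimal) auto
      then have le: "norm (W y) * norm (W y) \<le> norm (W y) * norm y"
        using Wc[of y] by (auto simp: cmod_cinner_self power2_eq_square)
      show ?thesis
      proof (cases "W y = 0")
        case False
        then have "0 < norm (W y)" by simp
        with le have "norm (W y) \<le> norm y" by (rule mult_left_le_imp_le)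
        then show ?thesis by simp
      qed simp
    qed
  qed
  have "T = adj W \<circ> S"
    by (rule ext, rule cinner_eqI_left) (simp add: W cinner_adj_left[OF Wb])
  then show thesis
    using that bounded_operators_adj[OF Wb] by blast
qed

section \<open>Hilbert--Schmidt and trace-class operators\<close>

text \<open>The square of the Hilbert--Schmidt norm, with value \<open>\<infinity>\<close> allowed.\<close>

definition hs_sum :: "('a::complex_hilbert_space \<Rightarrow> 'a) \<Rightarrow> ennreal" where
  "hs_sum T = (\<Sum>\<^sub>\<infinity>e\<in>some_basis. ennreal ((norm (T e))\<^sup>2))"

definition hilbert_schmidt :: "('a::complex_hilbert_space \<Rightarrow> 'a) set" where
  "hilbert_schmidt = {T \<in> bounded_operators. hs_sum T < \<infinity>}"

text \<open>By Parseval's identity both sides are the sum of the squared moduli of all matrix entries of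
  \<open>T\<close>, in the two orders of summation.\<close>

lemma hs_sum_adj:
  fixes T :: "'a::complex_hilbert_space \<Rightarrow> 'a"
  assumes T: "T \<in> bounded_operators"
  shows "hs_sum (adj T) = hs_sum T"
proof -
  let ?E = "some_basis :: 'a set"
  note parseval = parseval_ennreal[OF orthonormal_basis_some_basis]
  have "cmod (cinner (adj T e) f) = cmod (cinner (T f) e)" for e f
    unfolding cinner_adj_left[OF T] by (subst cinner_commute) simp
  then have "hs_sum (adj T) = (\<Sum>\<^sub>\<infinity>e\<in>?E. \<Sum>\<^sub>\<infinity>f\<in>?E. ennreal ((cmod (cinner (T f) e))\<^sup>2))"
    unfolding hs_sum_def by (simp flip: parseval)
  also have "\<dots> = (\<Sum>\<^sub>\<infinity>f\<in>?E. \<Sum>\<^sub>\<infinity>e\<in>?E. ennreal ((cmod (cinner (T f) e))\<^sup>2))"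
    by (rule infsum_swap_ennreal)
  also have "\<dots> = hs_sum T"
    unfolding hs_sum_def parseval ..
  finally show ?thesis .
qed

lemma pos_trace_adj_comp:
  "T \<in> bounded_operators \<Longrightarrow> pos_trace (adj T \<circ> T) = hs_sum T"
  unfolding pos_trace_def hs_sum_def by (simp add: cinner_adj_left norm_eq_cinner del: of_real_power)

lemma pos_trace_adj_comp_commute:
  assumes T: "T \<in> bounded_operators"
  shows "pos_trace (adj T \<circ> T) = pos_trace (T \<circ> adj T)"
  using pos_trace_adj_comp[OF bounded_operators_adj[OF T]] pos_trace_adj_comp[OF T]
  by (simp add: adj_adj[OF T] hs_sum_adj[OF T])

lemma hilbert_schmidt_bounded: "T \<in> hilbert_schmidt \<Longrightarrow> T \<in> bounded_operators"
  by (simp add: hilbert_schmidt_def)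

lemma hilbert_schmidt_adj: "T \<in> hilbert_schmidt \<Longrightarrow> adj T \<in> hilbert_schmidt"
  by (simp add: hilbert_schmidt_def bounded_operators_adj hs_sum_adj)

lemma hilbert_schmidt_comp_left:
  assumes U: "U \<in> bounded_operators" and T: "T \<in> hilbert_schmidt"
  shows "U \<circ> T \<in> hilbert_schmidt"
proof -
  obtain K where K: "K \<ge> 0" "\<And>x. norm (U x) \<le> K * norm x"
    using bounded_operators_bound[OF U] by metis
  have "hs_sum (U \<circ> T) \<le> (\<Sum>\<^sub>\<infinity>e\<in>some_basis. ennreal (K\<^sup>2) * ennreal ((norm (T e))\<^sup>2))"
    unfolding hs_sum_def
  proof (rule infsum_mono)
    show "ennreal ((norm ((U \<circ> T) e))\<^sup>2) \<le> ennreal (K\<^sup>2) * ennreal ((norm (T e))\<^sup>2)" for e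
      using power_mono[OF K(2)[of "T e"], of 2]
      by (simp add: power_mult_distrib ennreal_mult[symmetric] ennreal_leI)
  qed simp_all
  also have "\<dots> = ennreal (K\<^sup>2) * hs_sum T"
    unfolding hs_sum_def by (rule infsum_cmult_ennreal)
  also have "\<dots> < \<infinity>"
    using T by (simp add: hilbert_schmidt_def ennreal_mult_less_top)
  finally show ?thesis
    using U T by (simp add: hilbert_schmidt_def bounded_operators_comp)
qed

lemma hilbert_schmidt_zero: "(\<lambda>x. 0) \<in> hilbert_schmidt"
  by (simp add: hilbert_schmidt_def bounded_operators_zero_op hs_sum_def)

lemma trace_class_bounded: "T \<in> trace_class \<Longrightarrow> T \<in> bounded_operators"
  by (simp add: trace_class_def)

text \<open>With \<open>R\<close> the square root of the absolute value \<open>S\<close> of \<open>T\<close>, finiteness of the trace of \<open>S\<close>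
  means that \<open>R\<close> is Hilbert--Schmidt, and \<open>T = U S = (U R) R\<close>.\<close>

lemma trace_class_hilbert_schmidt_factors:
  assumes T: "T \<in> trace_class"
  obtains A B where "A \<in> hilbert_schmidt" "B \<in> hilbert_schmidt" "T = A \<circ> B"
proof -
  note Tb = trace_class_bounded[OF T]
  note S = positive_abs_operator[OF Tb]
  obtain R where R: "positive_operator R" "R \<circ> R = abs_operator T"
    by (rule positive_sqrt_exists[OF S]) (rule that)
  note Rb = positive_operator_bounded[OF R(1)]
  have "hs_sum R = pos_trace (abs_operator T)"
    using pos_trace_adj_comp[OF Rb] by (simp add: positive_operator_adj[OF R(1)] R(2))
  then have RH: "R \<in> hilbert_schmidt"
    using T Rb by (simp add: hilbert_schmidt_def trace_class_def)
  obtain U where U: "U \<in> bounded_operators" "T = U \<circ> abs_operator T"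
    by (rule douglas_factorization[OF Tb positive_operator_bounded[OF S]])
      (simp_all add: norm_abs_operator[OF Tb] that)
  have "T = (U \<circ> R) \<circ> R"
    unfolding comp_assoc R(2) by (rule U(2))
  with hilbert_schmidt_comp_left[OF U(1) RH] RH show thesis
    by (rule that)
qed

text \<open>The absolute value of the sum \<open>T = A B + C D\<close> has the form \<open>W T\<close>, so its diagonal entries are
  \<open>\<langle>B e, (W A)\<^sup>* e\<rangle> + \<langle>D e, (W C)\<^sup>* e\<rangle>\<close>, which are controlled by four Hilbert--Schmidt sums. Two
  summands are treated together in order to obtain closure under addition.\<close>

lemma trace_class_sum_hilbert_schmidt_products:
  assumes A: "A \<in> hilbert_schmidt" and B: "B \<in> hilbert_schmidt"
    and C: "C \<in> hilbert_schmidt" and D: "D \<in> hilbert_schmidt"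
  shows "(\<lambda>x. A (B x) + C (D x)) \<in> trace_class" (is "?T \<in> _")
proof -
  have Tb: "?T \<in> bounded_operators"
    using bounded_operators_plus[OF bounded_operators_comp bounded_operators_comp]
      A B C D hilbert_schmidt_bounded by fastforce
  note S = positive_abs_operator[OF Tb]
  obtain W where W: "W \<in> bounded_operators" "abs_operator ?T = W \<circ> ?T"
    by (rule douglas_factorization[OF positive_operator_bounded[OF S] Tb])
      (simp_all add: norm_abs_operator[OF Tb] that)
  define A' C' where "A' = adj (W \<circ> A)" and "C' = adj (W \<circ> C)"
  have A': "A' \<in> hilbert_schmidt" and C': "C' \<in> hilbert_schmidt"
    unfolding A'_def C'_def by (intro hilbert_schmidt_adj hilbert_schmidt_comp_left W A C)+
  have split: "Re (cinner x y) \<le> (norm x)\<^sup>2 + (norm y)\<^sup>2" for x y :: 'a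
  proof -
    have "Re (cinner x y) \<le> norm x * norm y"
      using norm_cauchy_schwarz[of x y] by (simp add: inner_eq_Re_cinner)
    moreover have "0 \<le> (norm x - norm y)\<^sup>2" "0 \<le> norm x * norm y" by simp_all
    ultimately show ?thesis unfolding power2_diff by linarith
  qed
  have "Re (cinner (abs_operator ?T e) e)
      \<le> ((norm (B e))\<^sup>2 + (norm (A' e))\<^sup>2) + ((norm (D e))\<^sup>2 + (norm (C' e))\<^sup>2)" for e
  proof -
    have "cinner (abs_operator ?T e) e = cinner ((W \<circ> A) (B e)) e + cinner ((W \<circ> C) (D e)) e"
      by (simp add: W(2) bounded_operators_add[OF W(1)] cinner_add_left)
    also have "\<dots> = cinner (B e) (A' e) + cinner (D e) (C' e)"
      unfolding A'_def C'_def
      by (simp only: cinner_adj_right[OF bounded_operators_comp[OF W(1) hilbert_schmidt_bounded[OF A]]]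
          cinner_adj_right[OF bounded_operators_comp[OF W(1) hilbert_schmidt_bounded[OF C]]])
    finally show ?thesis
      using split[of "B e" "A' e"] split[of "D e" "C' e"] by simp
  qed
  then have "pos_trace (abs_operator ?T) \<le> (\<Sum>\<^sub>\<infinity>e\<in>some_basis.
      (ennreal ((norm (B e))\<^sup>2) + ennreal ((norm (A' e))\<^sup>2))
      + (ennreal ((norm (D e))\<^sup>2) + ennreal ((norm (C' e))\<^sup>2)))"
    unfolding pos_trace_def
    by (intro infsum_mono) (simp_all add: ennreal_leI flip: ennreal_plus)
  also have "\<dots> = (hs_sum B + hs_sum A') + (hs_sum D + hs_sum C')"
    unfolding hs_sum_def by (simp add: infsum_add)
  also have "\<dots> < \<infinity>"
    using A' B C' D by (simp add: hilbert_schmidt_def)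
  finally show ?thesis
    using Tb by (simp add: trace_class_def)
qed

lemma trace_class_hilbert_schmidt_product:
  assumes "A \<in> hilbert_schmidt" "B \<in> hilbert_schmidt"
  shows "A \<circ> B \<in> trace_class"
  using trace_class_sum_hilbert_schmidt_products[OF assms hilbert_schmidt_zero hilbert_schmidt_zero]
  by (simp add: o_def)

lemma trace_class_plus:
  assumes S: "S \<in> trace_class" and T: "T \<in> trace_class"
  shows "(\<lambda>x. S x + T x) \<in> trace_class"
proof -
  obtain A B where AB: "A \<in> hilbert_schmidt" "B \<in> hilbert_schmidt" "S = A \<circ> B"
    using trace_class_hilbert_schmidt_factors[OF S] .
  obtain C D where CD: "C \<in> hilbert_schmidt" "D \<in> hilbert_schmidt" "T = C \<circ> D"
    using trace_class_hilbert_schmidt_factors[OF T] .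
  show ?thesis
    using trace_class_sum_hilbert_schmidt_products[OF AB(1,2) CD(1,2)] by (simp add: AB(3) CD(3))
qed

lemma trace_class_comp:
  assumes U: "U \<in> bounded_operators" and T: "T \<in> trace_class"
  shows "U \<circ> T \<in> trace_class"
proof -
  obtain A B where AB: "A \<in> hilbert_schmidt" "B \<in> hilbert_schmidt" "T = A \<circ> B"
    using trace_class_hilbert_schmidt_factors[OF T] .
  show ?thesis
    unfolding AB(3) comp_assoc[symmetric]
    by (intro trace_class_hilbert_schmidt_product hilbert_schmidt_comp_left U AB)
qed

lemma trace_class_adj:
  assumes T: "T \<in> trace_class"
  shows "adj T \<in> trace_class"
proof -
  obtain A B where AB: "A \<in> hilbert_schmidt" "B \<in> hilbert_schmidt" "T = A \<circ> B"
    using trace_class_hilbert_schmidt_factors[OF T] .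
  have "adj T = adj B \<circ> adj A"
    unfolding AB(3) by (intro adj_comp hilbert_schmidt_bounded AB)
  then show ?thesis
    using AB by (auto intro: trace_class_hilbert_schmidt_product hilbert_schmidt_adj)
qed

lemma star_subalgebra_Int_trace_class:
  assumes B: "star_subalgebra B"
  shows "star_subalgebra (B \<inter> trace_class)"
proof -
  have Bb: "X \<in> bounded_operators" if "X \<in> B" for X
    using B that by (auto simp: star_subalgebra_def subalgebra_def)
  have zero: "(\<lambda>x. 0) \<in> trace_class"
    using trace_class_hilbert_schmidt_product[OF hilbert_schmidt_zero hilbert_schmidt_zero]
    by (simp add: o_def)
  have scale: "(\<lambda>x. c *\<^sub>C X x) \<in> trace_class" if "X \<in> trace_class" for c X
    using trace_class_comp[OF bounded_operators_scale[OF bounded_operators_id] that, of c]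
    by (simp add: o_def)
  show ?thesis
    using B Bb unfolding star_subalgebra_def subalgebra_def
    by (auto simp: zero scale intro: trace_class_plus trace_class_comp trace_class_adj)
qed

text \<open>This is Parseval's identity for \<open>u\<close> and \<open>w\<close>.\<close>

lemma op_trace_rank_one:
  assumes "\<And>x. T x = cinner x w *\<^sub>C u"
  shows "op_trace T = cinner u w"
proof -
  have "((\<lambda>e. cinner u e * cinner e w) has_sum cinner u w) some_basis"
    by (rule parseval_has_sum[OF orthonormal_basis_some_basis])
  then show ?thesis
    unfolding op_trace_def assms by (intro infsumI) (simp add: cinner_scaleC_left mult.commute)
qed

lemma pos_trace_rank_one:
  assumes "\<And>x. T x = cinner x u *\<^sub>C u"
  shows "pos_trace T = ennreal ((norm u)\<^sup>2)"
proof -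
  have "Re (cinner (T e) e) = (cmod (cinner u e))\<^sup>2" for e
  proof -
    have "cinner (T e) e = cinner u e * cnj (cinner u e)"
      unfolding assms cinner_scaleC_left by (subst cinner_commute) (rule mult.commute)
    then show ?thesis
      unfolding complex_norm_square[symmetric] by simp
  qed
  then show ?thesis
    unfolding pos_trace_def by (simp add: parseval_ennreal[OF orthonormal_basis_some_basis])
qed

section \<open>Subalgebras and the vectors they generate\<close>

lemma subalgebraD:
  assumes "subalgebra B"
  shows subalgebra_bounded: "X \<in> B \<Longrightarrow> X \<in> bounded_operators"
    and subalgebra_zero: "(\<lambda>x. 0) \<in> B"
    and subalgebra_plus: "X \<in> B \<Longrightarrow> Y \<in> B \<Longrightarrow> (\<lambda>x. X x + Y x) \<in> B"
    and subalgebra_comp: "X \<in> B \<Longrightarrow> Y \<in> B \<Longrightarrow> X \<circ> Y \<in> B"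
    and subalgebra_scale: "X \<in> B \<Longrightarrow> (\<lambda>x. c *\<^sub>C X x) \<in> B"
  using assms by (auto simp: subalgebra_def)

lemma subalgebraI:
  assumes "B \<subseteq> bounded_operators" "(\<lambda>x. 0) \<in> B"
    and "\<And>X Y. X \<in> B \<Longrightarrow> Y \<in> B \<Longrightarrow> (\<lambda>x. X x + Y x) \<in> B"
    and "\<And>X Y. X \<in> B \<Longrightarrow> Y \<in> B \<Longrightarrow> X \<circ> Y \<in> B"
    and "\<And>c X. X \<in> B \<Longrightarrow> (\<lambda>x. c *\<^sub>C X x) \<in> B"
  shows "subalgebra B"
  using assms by (auto simp: subalgebra_def)

lemma subalgebra_bounded_operators: "subalgebra bounded_operators"
  unfolding subalgebra_def
  by (auto intro: bounded_operators_zero_op bounded_operators_plus bounded_operators_comp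
      bounded_operators_scale)

lemma subalgebra_hull:
  assumes "S \<subseteq> bounded_operators"
  shows "subalgebra (subalgebra hull S)"
proof -
  have "subalgebra hull S \<subseteq> bounded_operators"
    by (rule hull_minimal) (use assms subalgebra_bounded_operators in auto)
  then show ?thesis
    unfolding subalgebra_def hull_def by (auto simp: subalgebraD)
qed

text \<open>Those elements of the hull whose adjoint is in the hull form a subalgebra containing \<open>S\<close>.\<close>

lemma star_subalgebra_hull:
  assumes S: "S \<subseteq> bounded_operators" and adjS: "\<And>X. X \<in> S \<Longrightarrow> adj X \<in> S"
  shows "star_subalgebra (subalgebra hull S)"
proof -
  let ?H = "subalgebra hull S"
  note H = subalgebra_hull[OF S]
  note Hb = subalgebra_bounded[OF H]
  have "subalgebra {X \<in> ?H. adj X \<in> ?H}"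
    using Hb by (intro subalgebraI)
      (auto simp: adj_zero_op adj_plus adj_comp adj_scale Hb intro: subalgebraD[OF H])
  moreover have "S \<subseteq> {X \<in> ?H. adj X \<in> ?H}"
    using adjS by (auto intro: hull_inc)
  ultimately have "?H \<subseteq> {X \<in> ?H. adj X \<in> ?H}"
    by (rule_tac hull_minimal)
  with H show ?thesis
    by (auto simp: star_subalgebra_def)
qed

lemma subspace_cyclic_vectors:
  assumes B: "subalgebra B"
  shows "complex_vector.subspace ((\<lambda>X. X \<xi>) ` B)"
  unfolding complex_vector.subspace_def
proof (intro conjI ballI allI)
  show "0 \<in> (\<lambda>X. X \<xi>) ` B"
    by (rule image_eqI[OF _ subalgebra_zero[OF B]]) simp
  show "x + y \<in> (\<lambda>X. X \<xi>) ` B" if "x \<in> (\<lambda>X. X \<xi>) ` B" "y \<in> (\<lambda>X. X \<xi>) ` B" for x y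
    using that by (auto intro!: image_eqI[OF _ subalgebra_plus[OF B]])
  show "c *\<^sub>C x \<in> (\<lambda>X. X \<xi>) ` B" if "x \<in> (\<lambda>X. X \<xi>) ` B" for c x
    using that by (auto intro!: image_eqI[OF _ subalgebra_scale[OF B]])
qed

lemma cyclic_subspace_invariant:
  assumes B: "subalgebra B" and X: "X \<in> B" and v: "v \<in> closure ((\<lambda>X. X \<xi>) ` B)"
  shows "X v \<in> closure ((\<lambda>X. X \<xi>) ` B)"
proof -
  have "X ` ((\<lambda>X. X \<xi>) ` B) \<subseteq> (\<lambda>X. X \<xi>) ` B"
    using subalgebra_comp[OF B X] by (auto intro!: image_eqI[of _ _ "X \<circ> _"])
  moreover have "X ` closure ((\<lambda>X. X \<xi>) ` B) \<subseteq> closure (X ` ((\<lambda>X. X \<xi>) ` B))"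
    by (intro closure_bounded_linear_image_subset bounded_operators_linear subalgebra_bounded[OF B X])
  ultimately show ?thesis
    using v closure_mono by blast
qed

lemma orth_proj_span_singleton:
  fixes \<xi> :: "'a::complex_hilbert_space"
  assumes "norm \<xi> = 1"
  shows "orth_proj (complex_vector.span {\<xi>}) x = cinner x \<xi> *\<^sub>C \<xi>"
proof (rule orth_proj_eqI)
  show "cinner (x - cinner x \<xi> *\<^sub>C \<xi>) z = 0" if z: "z \<in> complex_vector.span {\<xi>}" for z
  proof -
    obtain c where "z = c *\<^sub>C \<xi>"
      using z by (auto simp: complex_vector.span_singleton)
    then show ?thesis
      using assms by (simp add: cinner_scaleC_right cinner_scaleC_left cinner.diff_left norm_eq_cinner)
  qed
  show "cinner x \<xi> *\<^sub>C \<xi> \<in> complex_vector.span {\<xi>}"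
    by (intro complex_vector.span_scale complex_vector.span_base) simp
qed (rule complex_vector.subspace_span)

section \<open>Alternating words\<close>

lemma op_prod_append: "op_prod (Xs @ Ys) = op_prod Xs \<circ> op_prod Ys"
  by (induction Xs) (auto simp: op_prod_def)

lemma op_prod_Cons: "op_prod (X # Xs) = X \<circ> op_prod Xs"
  and op_prod_Nil: "op_prod [] = id"
  by (simp_all add: op_prod_def)

text \<open>The end indices are recorded because they decide whether a concatenation of two words is again
  alternating; the empty word is excluded since it has no such indices.\<close>

definition alternating_word ::
  "'i set \<Rightarrow> ('i \<Rightarrow> ('a \<Rightarrow> 'a) set) \<Rightarrow> 'i \<Rightarrow> 'i \<Rightarrow> ('a \<Rightarrow> 'a) \<Rightarrow> bool" where
  "alternating_word I B i j T \<longleftrightarrow> (\<exists>ks Xs. ks \<noteq> [] \<and> set ks \<subseteq> I \<and> distinct_adj ks \<and>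
    list_all2 (\<lambda>X k. X \<in> B k) Xs ks \<and> hd ks = i \<and> last ks = j \<and> T = op_prod Xs)"

lemma alternating_wordI:
  "ks \<noteq> [] \<Longrightarrow> set ks \<subseteq> I \<Longrightarrow> distinct_adj ks \<Longrightarrow> list_all2 (\<lambda>X k. X \<in> B k) Xs ks \<Longrightarrow>
    alternating_word I B (hd ks) (last ks) (op_prod Xs)"
  unfolding alternating_word_def by blast

lemma alternating_word_letter: "i \<in> I \<Longrightarrow> X \<in> B i \<Longrightarrow> alternating_word I B i i X"
  using alternating_wordI[of "[i]" I B "[X]"] by (simp add: op_prod_Cons op_prod_Nil)

text \<open>If \<open>j \<noteq> k\<close> then concatenation suffices. Otherwise the last letter of the first word and the first
  letter of the second are multiplied into a single letter; its neighbours have different indices, so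
  no further merging can occur.\<close>

lemma alternating_word_comp:
  assumes B: "\<And>i. i \<in> I \<Longrightarrow> subalgebra (B i)"
    and S: "alternating_word I B i j S" and T: "alternating_word I B k l T"
  shows "alternating_word I B i l (S \<circ> T)"
proof -
  obtain ks Xs where ks: "ks \<noteq> []" "set ks \<subseteq> I" "distinct_adj ks"
    "list_all2 (\<lambda>X k. X \<in> B k) Xs ks" "hd ks = i" "last ks = j" "S = op_prod Xs"
    using S unfolding alternating_word_def by blast
  obtain ls Ys where ls: "ls \<noteq> []" "set ls \<subseteq> I" "distinct_adj ls"
    "list_all2 (\<lambda>X k. X \<in> B k) Ys ls" "hd ls = k" "last ls = l" "T = op_prod Ys"
    using T unfolding alternating_word_def by blast
  show ?thesis
  proof (cases "j = k")
    case False
    have "alternating_word I B (hd (ks @ ls)) (last (ks @ ls)) (op_prod (Xs @ Ys))"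
      using ks ls False
      by (intro alternating_wordI) (auto simp: distinct_adj_append_iff intro: list_all2_appendI)
    then show ?thesis
      using ks ls by (simp add: op_prod_append)
  next
    case True
    obtain ks' where ks': "ks = ks' @ [j]"
      using ks(1,6) by (metis append_butlast_last_id)
    obtain ls' where ls': "ls = j # ls'"
      using ls(1,5) True by (metis list.collapse)
    obtain Xs' X where Xs: "Xs = Xs' @ [X]" "list_all2 (\<lambda>X k. X \<in> B k) Xs' ks'" "X \<in> B j"
      using ks(4) unfolding ks' list_all2_append2 by (auto simp: list_all2_Cons2)
    obtain Y Ys' where Ys: "Ys = Y # Ys'" "Y \<in> B j" "list_all2 (\<lambda>X k. X \<in> B k) Ys' ls'"
      using ls(4) unfolding ls' by (auto simp: list_all2_Cons2)
    have XY: "X \<circ> Y \<in> B j"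
      using B[of j] ks(2) Xs(3) Ys(2) by (auto simp: ks' intro: subalgebra_comp)
    have "alternating_word I B (hd (ks' @ j # ls')) (last (ks' @ j # ls')) (op_prod (Xs' @ (X \<circ> Y) # Ys'))"
      using ks(2,3) ls(2,3) Xs(2) Ys(3) XY unfolding ks' ls'
      by (intro alternating_wordI) (auto simp: distinct_adj_append_iff intro: list_all2_appendI)
    moreover have "hd (ks' @ j # ls') = i"
      using ks(5) by (cases ks') (auto simp: ks')
    moreover have "op_prod (Xs' @ (X \<circ> Y) # Ys') = S \<circ> T"
      by (simp add: ks(7) ls(7) Xs(1) Ys(1) op_prod_append op_prod_Cons op_prod_Nil comp_assoc)
    ultimately show ?thesis
      using ls(6) by (simp add: ls')
  qed
qed

lemma alternating_word_bounded:
  assumes B: "\<And>i. i \<in> I \<Longrightarrow> B i \<subseteq> bounded_operators" and T: "alternating_word I B i j T"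
  shows "T \<in> bounded_operators"
proof -
  obtain ks Xs where ks: "set ks \<subseteq> I" "list_all2 (\<lambda>X k. X \<in> B k) Xs ks" and T: "T = op_prod Xs"
    using T unfolding alternating_word_def by blast
  from ks(2,1) have "op_prod Xs \<in> bounded_operators"
  proof (induction rule: list_all2_induct)
    case (Cons X Xs k ks)
    then have "X \<in> bounded_operators" "op_prod Xs \<in> bounded_operators"
      using B[of k] by auto
    then show ?case
      unfolding op_prod_Cons by (rule bounded_operators_comp)
  qed (simp add: op_prod_Nil bounded_operators_id)
  then show ?thesis by (simp add: T)
qed

lemma adj_op_prod:
  "set Xs \<subseteq> bounded_operators \<Longrightarrow> op_prod Xs \<in> bounded_operators \<and> adj (op_prod Xs) = op_prod (rev (map adj Xs))"
proof (induction Xs)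
  case Nil
  have "adj id = (id :: 'a \<Rightarrow> 'a)" by (rule adj_eqI) simp
  then show ?case
    unfolding list.map rev.simps op_prod_Nil using bounded_operators_id by blast
next
  case (Cons X Xs)
  then have X: "X \<in> bounded_operators" and Xs: "op_prod Xs \<in> bounded_operators"
    and IH: "adj (op_prod Xs) = op_prod (rev (map adj Xs))"
    by auto
  show ?case
    unfolding list.map rev.simps op_prod_append op_prod_Cons op_prod_Nil comp_id IH[symmetric]
    using bounded_operators_comp[OF X Xs] adj_comp[OF X Xs] by blast
qed

lemma alternating_word_adj:
  assumes B: "\<And>i. i \<in> I \<Longrightarrow> star_subalgebra (B i)" and T: "alternating_word I B i j T"
  shows "alternating_word I B j i (adj T)"
proof -
  obtain ks Xs where ks: "ks \<noteq> []" "set ks \<subseteq> I" "distinct_adj ks"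
    "list_all2 (\<lambda>X k. X \<in> B k) Xs ks" "hd ks = i" "last ks = j" and T: "T = op_prod Xs"
    using T unfolding alternating_word_def by blast
  have *: "list_all2 (\<lambda>X k. adj X \<in> B k \<and> X \<in> bounded_operators) Xs ks"
    using ks(4)
  proof (rule list.rel_mono_strong)
    fix X k assume "k \<in> set ks" "X \<in> B k"
    moreover from this have "star_subalgebra (B k)"
      using B ks(2) by blast
    ultimately show "adj X \<in> B k \<and> X \<in> bounded_operators"
      unfolding star_subalgebra_def using subalgebra_bounded by blast
  qed
  then have "set Xs \<subseteq> bounded_operators"
    by (induction rule: list_all2_induct) auto
  then have "adj T = op_prod (rev (map adj Xs))"
    using adj_op_prod T by blast
  moreover have "list_all2 (\<lambda>X k. X \<in> B k) (rev (map adj Xs)) (rev ks)"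
    unfolding list_all2_rev list_all2_map1 using * by (rule list_all2_mono) simp
  then have "alternating_word I B (hd (rev ks)) (last (rev ks)) (op_prod (rev (map adj Xs)))"
    using ks by (intro alternating_wordI) auto
  ultimately show ?thesis
    using ks by (simp add: hd_rev last_rev)
qed

text \<open>The definition of Boolean independence speaks of words of length at least two; for a single
  letter both sides agree trivially.\<close>

lemma boolean_independent_prod_list:
  assumes ind: "boolean_independent I B \<phi>"
    and ks: "ks \<noteq> []" "set ks \<subseteq> I" "distinct_adj ks" "list_all2 (\<lambda>X k. X \<in> B k) Xs ks"
  shows "\<phi> (op_prod Xs) = prod_list (map \<phi> Xs)"
proof (cases "length ks \<ge> 2")
  case True
  then show ?thesis
    using ind ks unfolding boolean_independent_def by blast
next
  case False
  with ks(1) have "length ks = 1"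
    by (cases ks) (auto simp: not_less_eq_eq numeral_2_eq_2)
  then obtain X where "Xs = [X]"
    using list_all2_lengthD[OF ks(4)] by (auto simp: length_Suc_conv)
  then show ?thesis by (simp add: op_prod_Cons op_prod_Nil)
qed

lemma boolean_independent_word_comp:
  assumes ind: "boolean_independent I B \<phi>"
    and S: "alternating_word I B i j S" and T: "alternating_word I B k l T" and "j \<noteq> k"
  shows "\<phi> (S \<circ> T) = \<phi> S * \<phi> T"
proof -
  obtain ks Xs where ks: "ks \<noteq> []" "set ks \<subseteq> I" "distinct_adj ks"
    "list_all2 (\<lambda>X k. X \<in> B k) Xs ks" "hd ks = i" "last ks = j" "S = op_prod Xs"
    using S unfolding alternating_word_def by blast
  obtain ls Ys where ls: "ls \<noteq> []" "set ls \<subseteq> I" "distinct_adj ls"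
    "list_all2 (\<lambda>X k. X \<in> B k) Ys ls" "hd ls = k" "last ls = l" "T = op_prod Ys"
    using T unfolding alternating_word_def by blast
  have "\<phi> (op_prod (Xs @ Ys)) = prod_list (map \<phi> (Xs @ Ys))"
    using ks ls \<open>j \<noteq> k\<close>
    by (intro boolean_independent_prod_list[OF ind, of "ks @ ls"])
      (auto simp: distinct_adj_append_iff intro: list_all2_appendI)
  then show ?thesis
    using boolean_independent_prod_list[OF ind ks(1-4)] boolean_independent_prod_list[OF ind ls(1-4)]
    by (simp add: op_prod_append ks(7) ls(7))
qed

section \<open>Boolean independent families containing the rank-one projection\<close>

locale boolean_independent_family =
  fixes \<xi> :: "'a::complex_hilbert_space" and I :: "'i set" and B :: "'i \<Rightarrow> ('a \<Rightarrow> 'a) set"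
  assumes unit: "norm \<xi> = 1"
    and independent: "boolean_independent I B (vector_state \<xi>)"
    and proj_mem: "\<And>i. i \<in> I \<Longrightarrow> orth_proj (complex_vector.span {\<xi>}) \<in> B i"
begin

definition B_hat :: "('a \<Rightarrow> 'a) set" where
  "B_hat = subalgebra hull (\<Union>i\<in>I. B i)"

definition H_hat :: "'a set" where
  "H_hat = closure ((\<lambda>X. X \<xi>) ` B_hat)"

abbreviation P_hat :: "'a \<Rightarrow> 'a" where
  "P_hat \<equiv> orth_proj H_hat"

abbreviation word :: "'i \<Rightarrow> 'i \<Rightarrow> ('a \<Rightarrow> 'a) \<Rightarrow> bool" where
  "word \<equiv> alternating_word I B"

lemma star_B: "i \<in> I \<Longrightarrow> star_subalgebra (B i)"
  using independent by (simp add: boolean_independent_def)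

lemma subalgebra_B: "i \<in> I \<Longrightarrow> subalgebra (B i)"
  using star_B by (simp add: star_subalgebra_def)

lemma star_B_hat: "star_subalgebra B_hat"
  unfolding B_hat_def
proof (rule star_subalgebra_hull)
  show "(\<Union>i\<in>I. B i) \<subseteq> bounded_operators"
    using subalgebra_B by (auto dest: subalgebra_bounded)
  show "adj X \<in> (\<Union>i\<in>I. B i)" if "X \<in> (\<Union>i\<in>I. B i)" for X
    using that star_B unfolding star_subalgebra_def by blast
qed

lemma subalgebra_B_hat: "subalgebra B_hat"
  using star_B_hat by (simp add: star_subalgebra_def)

lemma B_hat_bounded: "X \<in> B_hat \<Longrightarrow> X \<in> bounded_operators"
  by (rule subalgebra_bounded[OF subalgebra_B_hat])

lemma adj_B_hat: "X \<in> B_hat \<Longrightarrow> adj X \<in> B_hat"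
  using star_B_hat by (simp add: star_subalgebra_def)

lemma B_subset_B_hat: "i \<in> I \<Longrightarrow> X \<in> B i \<Longrightarrow> X \<in> B_hat"
  unfolding B_hat_def by (rule hull_inc) auto

lemma H_hat_subspace: "complex_vector.subspace H_hat"
  unfolding H_hat_def by (intro closure_complex_subspace subspace_cyclic_vectors subalgebra_B_hat)

lemma H_hat_closed: "closed H_hat"
  by (simp add: H_hat_def)

lemma B_hat_vector: "X \<in> B_hat \<Longrightarrow> X \<xi> \<in> H_hat"
  unfolding H_hat_def using closure_subset by fast

lemma B_hat_invariant: "X \<in> B_hat \<Longrightarrow> v \<in> H_hat \<Longrightarrow> X v \<in> H_hat"
  unfolding H_hat_def by (rule cyclic_subspace_invariant[OF subalgebra_B_hat])

lemmas P_hat_mem = orth_proj_mem[OF H_hat_subspace H_hat_closed]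
  and P_hat_orthogonal = orth_proj_orthogonal[OF H_hat_subspace H_hat_closed]
  and P_hat_bounded = bounded_operators_orth_proj[OF H_hat_subspace H_hat_closed]
  and P_hat_self_adjoint = orth_proj_self_adjoint[OF H_hat_subspace H_hat_closed]
  and P_hat_fixes = orth_proj_fixes[OF H_hat_subspace]

text \<open>Both \<open>X\<close> and its adjoint leave \<open>H_hat\<close> invariant.\<close>

lemma P_hat_commute:
  assumes X: "X \<in> B_hat"
  shows "P_hat (X x) = X (P_hat x)"
proof (rule orth_proj_eqI[OF H_hat_subspace])
  note Xb = B_hat_bounded[OF X]
  show "X (P_hat x) \<in> H_hat"
    by (rule B_hat_invariant[OF X P_hat_mem])
  show "cinner (X x - X (P_hat x)) z = 0" if "z \<in> H_hat" for z
    unfolding bounded_operators_diff[OF Xb, symmetric] cinner_adj_right[OF Xb]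
    by (rule P_hat_orthogonal[OF B_hat_invariant[OF adj_B_hat[OF X] that]])
qed

subsection \<open>Factorization through the rank-one projection\<close>

lemma word_letter: "i \<in> I \<Longrightarrow> X \<in> B i \<Longrightarrow> word i i X"
  by (rule alternating_word_letter)

lemma word_bounded: "word i j T \<Longrightarrow> T \<in> bounded_operators"
  by (rule alternating_word_bounded) (use subalgebra_B in \<open>auto dest: subalgebra_bounded\<close>)

lemma word_comp: "word i j S \<Longrightarrow> word k l T \<Longrightarrow> word i l (S \<circ> T)"
  by (rule alternating_word_comp[OF subalgebra_B])

lemma word_adj: "word i j T \<Longrightarrow> word j i (adj T)"
  by (rule alternating_word_adj[OF star_B])

definition word_vectors :: "'a set" where
  "word_vectors = complex_vector.span {T \<xi> | i j T. word i j T}"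

lemma word_vectors_base: "word i j T \<Longrightarrow> T \<xi> \<in> word_vectors"
  unfolding word_vectors_def by (rule complex_vector.span_base) auto

lemma word_vectors_subspace: "complex_vector.subspace word_vectors"
  unfolding word_vectors_def by (rule complex_vector.subspace_span)

lemma letter_word_vectors:
  assumes i: "i \<in> I" "X \<in> B i" and v: "v \<in> word_vectors"
  shows "X v \<in> word_vectors"
proof -
  have W: "word i i X" by (rule word_letter[OF i])
  note Xb = bounded_operatorsD[OF word_bounded[OF W]]
  have "word_vectors \<subseteq> {v. X v \<in> word_vectors}"
    unfolding word_vectors_def
  proof (rule complex_vector.span_minimal)
    show "{T \<xi> |i j T. word i j T} \<subseteq> {v. X v \<in> complex_vector.span {T \<xi> |i j T. word i j T}}"
      using word_vectors_base[OF word_comp[OF W]] by (auto simp: word_vectors_def)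
    show "complex_vector.subspace {v. X v \<in> complex_vector.span {T \<xi> |i j T. word i j T}}"
      unfolding complex_vector.subspace_def
      by (auto simp: Xb complex_vector.span_zero complex_vector.span_add complex_vector.span_scale)
  qed
  then show ?thesis using v by blast
qed

text \<open>The operators that map \<open>\<xi>\<close> and all word vectors to word vectors form a subalgebra. It contains
  every letter, because a letter times a word is a word, hence it contains all of \<open>B_hat\<close>.\<close>

lemma H_hat_subset_closure_word_vectors: "H_hat \<subseteq> closure word_vectors"
proof -
  note V = word_vectors_subspace
  let ?D = "{X \<in> bounded_operators. X \<xi> \<in> word_vectors \<and> (\<forall>v\<in>word_vectors. X v \<in> word_vectors)}"
  have "subalgebra ?D"
    by (rule subalgebraI)
      (auto simp: bounded_operators_zero_op bounded_operators_plus bounded_operators_comp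
        bounded_operators_scale complex_vector.subspace_0[OF V] complex_vector.subspace_add[OF V]
        complex_vector.subspace_scale[OF V])
  moreover have "(\<Union>i\<in>I. B i) \<subseteq> ?D"
    using letter_word_vectors word_vectors_base[OF word_letter]
      subalgebra_bounded[OF subalgebra_B] by auto
  ultimately have "B_hat \<subseteq> ?D"
    unfolding B_hat_def by (rule_tac hull_minimal)
  then show ?thesis
    unfolding H_hat_def by (intro closure_mono) auto
qed

lemma word_mem_B_hat:
  assumes T: "word i j T"
  shows "T \<in> B_hat"
proof -
  obtain ks Xs where ks: "ks \<noteq> []" "set ks \<subseteq> I" "list_all2 (\<lambda>X k. X \<in> B k) Xs ks" and T: "T = op_prod Xs"
    using T unfolding alternating_word_def by blast
  from ks(3,1,2) have "op_prod Xs \<in> B_hat"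
  proof (induction rule: list_all2_induct)
    case (Cons X Xs k ks)
    then have X: "X \<in> B_hat" by (auto intro: B_subset_B_hat)
    show ?case
    proof (cases "ks = []")
      case True
      with Cons X show ?thesis by (simp add: op_prod_Cons op_prod_Nil)
    next
      case False
      with Cons have "op_prod Xs \<in> B_hat" by simp
      with X show ?thesis
        unfolding op_prod_Cons by (rule subalgebra_comp[OF subalgebra_B_hat])
    qed
  qed simp
  then show ?thesis by (simp add: T)
qed

text \<open>At \<open>W \<xi>\<close> with a word \<open>W\<close>, the difference \<open>d\<close> of \<open>X Y\<close> and \<open>X P\<^sub>0 Y\<close> is a
  combination of word vectors. It is orthogonal to every \<open>Z \<xi>\<close>, because Boolean independence applies to the
  alternating words \<open>Z\<^sup>* X\<close> and \<open>Y W\<close>; so \<open>d = 0\<close>. Linearity and continuity extend this to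
  \<open>H_hat\<close>.\<close>

lemma word_factorization:
  assumes X: "word a i X" and Y: "word j b Y" and ij: "i \<noteq> j" and v: "v \<in> H_hat"
  shows "X (Y v) = cinner (Y v) \<xi> *\<^sub>C X \<xi>"
proof -
  note Xb = word_bounded[OF X] and Yb = word_bounded[OF Y]
  have base: "X (Y (W \<xi>)) = cinner (Y (W \<xi>)) \<xi> *\<^sub>C X \<xi>" if W: "word p q W" for p q W
  proof -
    define d where "d = X (Y (W \<xi>)) - cinner (Y (W \<xi>)) \<xi> *\<^sub>C X \<xi>"
    have d: "d \<in> word_vectors"
    proof -
      have "(X \<circ> (Y \<circ> W)) \<xi> \<in> word_vectors"
        by (rule word_vectors_base[OF word_comp[OF X word_comp[OF Y W]]])
      then show ?thesis
        unfolding d_def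
        by (intro complex_vector.subspace_diff[OF word_vectors_subspace]
            complex_vector.subspace_scale[OF word_vectors_subspace] word_vectors_base[OF X]) simp
    qed
    have "cinner d (Z \<xi>) = 0" if Z: "word r s Z" for r s Z
    proof -
      note Zb = word_bounded[OF Z]
      have "vector_state \<xi> ((adj Z \<circ> X) \<circ> (Y \<circ> W)) = vector_state \<xi> (adj Z \<circ> X) * vector_state \<xi> (Y \<circ> W)"
        by (rule boolean_independent_word_comp[OF independent word_comp[OF word_adj[OF Z] X]
              word_comp[OF Y W] ij])
      then show ?thesis
        by (simp add: vector_state_def d_def cinner.diff_left cinner_scaleC_left
            cinner_adj_left[OF Zb])
    qed
    then have "word_vectors \<subseteq> {z. cinner d z = 0}"
      unfolding word_vectors_def
      by (intro complex_vector.span_minimal)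
        (auto simp: complex_vector.subspace_def cinner.zero_right cinner_add_right cinner_scaleC_right)
    with d have "cinner d d = 0" by blast
    then show ?thesis by (simp add: norm_eq_cinner d_def)
  qed
  let ?K = "{v. X (Y v) = cinner (Y v) \<xi> *\<^sub>C X \<xi>}"
  have "complex_vector.subspace ?K"
    by (simp add: complex_vector.subspace_def bounded_operatorsD[OF Xb] bounded_operatorsD[OF Yb]
        cinner_add_left cinner_scaleC_left scaleC_add_left scaleC_scaleC cinner.zero_left)
  then have "word_vectors \<subseteq> ?K"
    unfolding word_vectors_def using base by (intro complex_vector.span_minimal) auto
  moreover have "closed ?K"
  proof (rule closed_Collect_eq)
    have cY: "continuous_on UNIV Y"
      by (rule linear_continuous_on[OF bounded_operators_linear[OF Yb]])
    show "continuous_on UNIV (\<lambda>v. X (Y v))"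
      by (rule linear_continuous_on[OF bounded_operators_linear[OF bounded_operators_comp[OF Xb Yb], unfolded o_def]])
    show "continuous_on UNIV (\<lambda>v. cinner (Y v) \<xi> *\<^sub>C X \<xi>)"
      by (intro scaleC.continuous_on cinner.continuous_on continuous_on_const cY)
  qed
  ultimately have "closure word_vectors \<subseteq> ?K"
    by (rule closure_minimal)
  then show ?thesis
    using v H_hat_subset_closure_word_vectors by blast
qed

subsection \<open>The trace\<close>

lemma pos_trace_compression:
  "pos_trace (P_hat \<circ> X \<circ> P_hat) = (\<Sum>\<^sub>\<infinity>e\<in>some_basis. ennreal (Re (cinner (X (P_hat e)) (P_hat e))))"
  unfolding pos_trace_def by (simp add: P_hat_self_adjoint)

lemma trace_on_B_hat: "trace_on B_hat (\<lambda>X. pos_trace (P_hat \<circ> X \<circ> P_hat))"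
  unfolding trace_on_def
proof (intro conjI ballI impI allI)
  fix X Y :: "'a \<Rightarrow> 'a" assume "positive_operator X \<and> positive_operator Y"
  then show "pos_trace (P_hat \<circ> (\<lambda>x. X x + Y x) \<circ> P_hat)
      = pos_trace (P_hat \<circ> X \<circ> P_hat) + pos_trace (P_hat \<circ> Y \<circ> P_hat)"
    unfolding pos_trace_compression
    by (simp add: cinner_add_left positive_operator_nonneg infsum_add)
next
  fix X :: "'a \<Rightarrow> 'a" and r :: real assume "0 \<le> r" "positive_operator X"
  then show "pos_trace (P_hat \<circ> (\<lambda>x. r *\<^sub>R X x) \<circ> P_hat) = ennreal r * pos_trace (P_hat \<circ> X \<circ> P_hat)"
    unfolding pos_trace_compression
    by (simp add: scaleR_scaleC cinner_scaleC_left positive_operator_nonneg ennreal_mult infsum_cmult_ennreal)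
next
  fix X assume X: "X \<in> B_hat"
  note Xb = B_hat_bounded[OF X]
  let ?T = "X \<circ> P_hat"
  have T: "?T \<in> bounded_operators"
    by (rule bounded_operators_comp[OF Xb P_hat_bounded])
  have adjP: "adj P_hat = P_hat"
    by (rule adj_eqI) (rule P_hat_self_adjoint)
  have adjT: "adj ?T = P_hat \<circ> adj X"
    by (simp add: adj_comp[OF Xb P_hat_bounded] adjP)
  have "P_hat \<circ> (adj X \<circ> X) \<circ> P_hat = adj ?T \<circ> ?T"
    by (simp add: adjT comp_assoc)
  moreover have "P_hat \<circ> (X \<circ> adj X) \<circ> P_hat = ?T \<circ> adj ?T"
    by (simp add: adjT fun_eq_iff P_hat_commute[OF X] P_hat_commute[OF adj_B_hat[OF X]])
  ultimately show "pos_trace (P_hat \<circ> (adj X \<circ> X) \<circ> P_hat) = pos_trace (P_hat \<circ> (X \<circ> adj X) \<circ> P_hat)"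
    using pos_trace_adj_comp_commute[OF T] by simp
qed

text \<open>With \<open>v = Z \<xi>\<close> and \<open>u = X v\<close>, the operator \<open>X Z P\<^sub>0 Z\<^sup>* X\<close> is \<open>x \<mapsto> \<langle>x, u\<rangle> u\<close>. The
  Cauchy--Schwarz inequality \<open>\<bar>\<langle>X x, v\<rangle>\<bar>\<^sup>2 \<le> \<langle>X x, x\<rangle> \<langle>X v, v\<rangle>\<close> bounds it by \<open>\<langle>X v, v\<rangle> X\<close>, and \<open>w\<close> is
  \<open>u\<close> rescaled accordingly.\<close>

lemma rank_one_below:
  assumes X: "X \<in> B_hat" "positive_operator X" and Z: "Z \<in> B_hat" and nz: "X (Z \<xi>) \<noteq> 0"
  obtains w where "w \<noteq> 0" "w \<in> H_hat" "(\<lambda>x. cinner x w *\<^sub>C w) \<in> B_hat"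
    "positive_operator (\<lambda>x. X x - cinner x w *\<^sub>C w)"
proof -
  note Xb = B_hat_bounded[OF X(1)] and Zb = B_hat_bounded[OF Z]
  \<comment> \<open>An empty family generates the zero algebra, which contains no \<open>X\<close> with \<open>X (Z \<xi>) \<noteq> 0\<close>.\<close>
  have "I \<noteq> {}"
  proof
    assume "I = {}"
    have "subalgebra {\<lambda>x :: 'a. 0 :: 'a}"
      by (rule subalgebraI) (auto simp: bounded_operators_zero_op)
    then have "B_hat \<subseteq> {\<lambda>x. 0}"
      unfolding B_hat_def using \<open>I = {}\<close> by (rule_tac hull_minimal) auto
    then show False using X(1) nz by auto
  qed
  then have P0: "orth_proj (complex_vector.span {\<xi>}) \<in> B_hat"
    using proj_mem B_subset_B_hat by blast
  define v u where "v = Z \<xi>" and "u = X v"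
  define c where "c = Re (cinner (X v) v)"
  have c: "0 < c"
    using positive_operator_nonneg[OF X(2), of v] positive_operator_null[OF X(2), of v] nz
    by (auto simp: c_def v_def less_le)
  define s where "s = complex_of_real (sqrt (1 / c))"
  have ss: "s * cnj s = complex_of_real (1 / c)"
    using c by (simp add: s_def flip: of_real_mult)
  define w where "w = s *\<^sub>C u"
  have wx: "cinner x w *\<^sub>C w = complex_of_real (1 / c) *\<^sub>C cinner x u *\<^sub>C u" for x
    unfolding w_def cinner_scaleC_right scaleC_scaleC ss[symmetric] by (simp add: ac_simps)
  show thesis
  proof
    show "w \<noteq> 0"
      using nz c by (simp add: w_def s_def u_def v_def)
    show "w \<in> H_hat"
      unfolding w_def u_def v_def
      by (rule complex_vector.subspace_scale[OF H_hat_subspace B_hat_invariant[OF X(1) B_hat_vector[OF Z]]])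
    have "(X \<circ> (Z \<circ> (orth_proj (complex_vector.span {\<xi>}) \<circ> (adj Z \<circ> X)))) x = cinner x u *\<^sub>C u" for x
    proof -
      have "cinner (adj Z (X x)) \<xi> = cinner x u"
        unfolding cinner_adj_left[OF Zb] u_def v_def by (rule positive_operator_self_adjoint[OF X(2)])
      then show ?thesis
        by (simp add: orth_proj_span_singleton[OF unit] bounded_operatorsD[OF Xb] bounded_operatorsD[OF Zb]
            u_def v_def)
    qed
    then have eq: "(\<lambda>x. cinner x w *\<^sub>C w) = (\<lambda>x. complex_of_real (1 / c) *\<^sub>C
        (X \<circ> (Z \<circ> (orth_proj (complex_vector.span {\<xi>}) \<circ> (adj Z \<circ> X)))) x)"
      unfolding wx by (rule_tac ext) simp
    show "(\<lambda>x. cinner x w *\<^sub>C w) \<in> B_hat"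
      unfolding eq
      by (intro subalgebra_scale[OF subalgebra_B_hat] subalgebra_comp[OF subalgebra_B_hat]
          X(1) Z P0 adj_B_hat)
    then have Yb: "(\<lambda>x. cinner x w *\<^sub>C w) \<in> bounded_operators"
      by (rule B_hat_bounded)
    have "cinner (X x - cinner x w *\<^sub>C w) x \<in> \<real>\<^sub>\<ge>\<^sub>0" for x
    proof -
      have "cinner (cinner x w *\<^sub>C w) x = complex_of_real (1 / c) * (cinner x u * cnj (cinner x u))"
        unfolding wx cinner_scaleC_left by (subst (2) cinner_commute) (rule refl)
      also have "\<dots> = complex_of_real ((cmod (cinner x u))\<^sup>2 / c)"
        unfolding complex_norm_square[symmetric] by simp
      finally have "cinner (X x - cinner x w *\<^sub>C w) x
          = complex_of_real (Re (cinner (X x) x) - (cmod (cinner x u))\<^sup>2 / c)"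
        using positive_operator_real[OF X(2), of x] by (simp add: cinner.diff_left)
      moreover have "(cmod (cinner x u))\<^sup>2 \<le> Re (cinner (X x) x) * c"
        unfolding c_def u_def positive_operator_self_adjoint[OF X(2), symmetric]
        by (rule positive_operator_cauchy_schwarz[OF X(2)])
      ultimately show ?thesis
        using c by (simp add: complex_nonneg_Reals_iff pos_divide_le_eq)
    qed
    then show "positive_operator (\<lambda>x. X x - cinner x w *\<^sub>C w)"
      using bounded_operators_minus[OF Xb Yb] by (simp add: positive_operator_def)
  qed
qed

lemma semifinite_trace_on_B_hat: "semifinite_trace_on B_hat (\<lambda>X. pos_trace (P_hat \<circ> X \<circ> P_hat))"
  unfolding semifinite_trace_on_def
proof (intro conjI ballI impI trace_on_B_hat)
  fix X assume X: "X \<in> B_hat" and "positive_operator X \<and> X \<noteq> (\<lambda>x. 0)"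
  then have Xp: "positive_operator X" and Xnz: "X \<noteq> (\<lambda>x. 0)" by auto
  note Xb = B_hat_bounded[OF X]
  show "\<exists>Y\<in>B_hat. positive_operator Y \<and> Y \<noteq> (\<lambda>x. 0) \<and> positive_operator (\<lambda>x. X x - Y x) \<and>
    pos_trace (P_hat \<circ> Y \<circ> P_hat) < \<infinity>"
  proof (cases "\<exists>Z\<in>B_hat. X (Z \<xi>) \<noteq> 0")
    case True
    then obtain w where w: "w \<noteq> 0" "w \<in> H_hat" "(\<lambda>x. cinner x w *\<^sub>C w) \<in> B_hat"
      "positive_operator (\<lambda>x. X x - cinner x w *\<^sub>C w)"
      using rank_one_below[OF X Xp] by blast
    have "positive_operator (\<lambda>x. cinner x w *\<^sub>C w)"
    proof -
      have "cinner (cinner x w *\<^sub>C w) x = complex_of_real ((cmod (cinner x w))\<^sup>2)" for x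
        unfolding cinner_scaleC_left complex_norm_square by (subst (2) cinner_commute) (rule refl)
      then show ?thesis
        using B_hat_bounded[OF w(3)]
        by (simp add: positive_operator_def complex_nonneg_Reals_iff del: of_real_power)
    qed
    moreover have "(\<lambda>x. cinner x w *\<^sub>C w) \<noteq> (\<lambda>x. 0)"
    proof
      assume "(\<lambda>x. cinner x w *\<^sub>C w) = (\<lambda>x. 0)"
      from fun_cong[OF this, of w] show False
        using w(1) by (simp add: norm_eq_cinner)
    qed
    moreover have "pos_trace (P_hat \<circ> (\<lambda>x. cinner x w *\<^sub>C w) \<circ> P_hat) = ennreal ((norm w)\<^sup>2)"
      by (rule pos_trace_rank_one)
        (simp add: bounded_operators_scaleC[OF P_hat_bounded] P_hat_self_adjoint P_hat_fixes w(2))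
    ultimately show ?thesis
      using w(3,4) by (intro bexI[of _ "\<lambda>x. cinner x w *\<^sub>C w"]) auto
  next
    case False
    then have "cinner x (X (Z \<xi>)) = 0" if "Z \<in> B_hat" for x Z
      using that by (simp add: cinner.zero_right)
    then have "cinner (X x) z = 0" if "z \<in> H_hat" for x z
      using that unfolding H_hat_def
      by (rule_tac orthogonal_to_closure) (auto simp: positive_operator_self_adjoint[OF Xp])
    then have "pos_trace (P_hat \<circ> X \<circ> P_hat) = 0"
      unfolding pos_trace_compression by (simp add: P_hat_mem)
    moreover have "positive_operator (\<lambda>x. 0 :: 'a)"
      by (simp add: positive_operator_def bounded_operators_zero_op cinner.zero_left)
    ultimately show ?thesis
      using X Xp Xnz by (intro bexI[of _ X]) auto
  qed
qed

text \<open>Split off the first letter \<open>X\<close> and call the rest \<open>T\<close>. The word factorization makes the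
  compression to \<open>H_hat\<close> a rank-one operator with trace \<open>\<phi>(T X)\<close>, and the cyclic condition
  on the indices allows Boolean independence to be used once more for \<open>T X\<close>.\<close>

lemma op_trace_cyclic_word:
  assumes ks: "length ks \<ge> 2" "set ks \<subseteq> I" "distinct_adj ks" "last ks \<noteq> hd ks"
    and Xs: "list_all2 (\<lambda>X k. X \<in> B k) Xs ks"
  shows "op_trace (P_hat \<circ> op_prod Xs \<circ> P_hat) = prod_list (map (vector_state \<xi>) Xs)"
proof -
  obtain k ls where kls: "ks = k # ls" "ls \<noteq> []"
    using ks(1) by (cases ks) (auto simp: Suc_le_eq)
  obtain X Ys where XYs: "Xs = X # Ys" "X \<in> B k" "list_all2 (\<lambda>X k. X \<in> B k) Ys ls"
    using Xs unfolding kls by (auto simp: list_all2_Cons2)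
  have ls: "set ls \<subseteq> I" "distinct_adj ls" "k \<in> I" "k \<noteq> hd ls" "last ls \<noteq> k"
    using ks kls by (auto simp: distinct_adj_Cons)
  define T where "T = op_prod Ys"
  have X: "word k k X"
    by (rule word_letter[OF ls(3) XYs(2)])
  have T: "word (hd ls) (last ls) T"
    unfolding T_def by (rule alternating_wordI[OF kls(2) ls(1,2) XYs(3)])
  note Tb = word_bounded[OF T]
  have X\<xi>: "X \<xi> \<in> H_hat"
    by (rule B_hat_vector[OF word_mem_B_hat[OF X]])
  have "(P_hat \<circ> op_prod Xs \<circ> P_hat) x = cinner x (P_hat (adj T \<xi>)) *\<^sub>C X \<xi>" for x
  proof -
    have "(P_hat \<circ> op_prod Xs \<circ> P_hat) x = P_hat (cinner (T (P_hat x)) \<xi> *\<^sub>C X \<xi>)"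
      by (simp add: XYs(1) op_prod_Cons flip: T_def word_factorization[OF X T ls(4) P_hat_mem])
    then show ?thesis
      by (simp add: bounded_operators_scaleC[OF P_hat_bounded] P_hat_fixes[OF X\<xi>]
          cinner_adj_right[OF Tb] P_hat_self_adjoint)
  qed
  then have "op_trace (P_hat \<circ> op_prod Xs \<circ> P_hat) = cinner (X \<xi>) (P_hat (adj T \<xi>))"
    by (rule op_trace_rank_one[of "P_hat \<circ> op_prod Xs \<circ> P_hat"])
  also have "\<dots> = vector_state \<xi> (T \<circ> X)"
    by (simp add: vector_state_def cinner_adj_right[OF Tb] P_hat_fixes[OF X\<xi>] flip: P_hat_self_adjoint)
  also have "\<dots> = vector_state \<xi> T * vector_state \<xi> X"
    by (rule boolean_independent_word_comp[OF independent T X ls(5)])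
  also have "vector_state \<xi> T = prod_list (map (vector_state \<xi>) Ys)"
    unfolding T_def by (rule boolean_independent_prod_list[OF independent kls(2) ls(1,2) XYs(3)])
  finally show ?thesis
    by (simp only: XYs(1) list.map prod_list.Cons mult.commute)
qed

lemma cyclic_boolean_independent_trace_class:
  "cyclic_boolean_independent I (\<lambda>i. B i \<inter> trace_class) (vector_state \<xi>)
    (\<lambda>X. op_trace (P_hat \<circ> X \<circ> P_hat))"
proof -
  have mono: "list_all2 (\<lambda>X k. X \<in> B k) Xs ks"
    if "list_all2 (\<lambda>X k. X \<in> B k \<inter> trace_class) Xs ks" for Xs ks
    using that by (rule list_all2_mono) simp
  have "boolean_independent I (\<lambda>i. B i \<inter> trace_class) (vector_state \<xi>)"
    using independent mono unfolding boolean_independent_def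
    by (blast intro: star_subalgebra_Int_trace_class)
  then show ?thesis
    unfolding cyclic_boolean_independent_def
    using op_trace_cyclic_word mono by blast
qed

end

section \<open>Semifiniteness of the trace and cyclic-Boolean independence\<close>

theorem theorem3p10:
  fixes \<xi> :: "'a::complex_hilbert_space"
    and A :: "('a \<Rightarrow> 'a) set"
    and I :: "'i set"
    and A_fam :: "'i \<Rightarrow> ('a \<Rightarrow> 'a) set"
    and A_hat :: "('a \<Rightarrow> 'a) set"
    and P_hat :: "'a \<Rightarrow> 'a"
  assumes "star_subalgebra A"
    and "norm \<xi> = 1"
    and "\<And>i. i \<in> I \<Longrightarrow> star_subalgebra (A_fam i) \<and> A_fam i \<subseteq> A"
    and "boolean_independent I A_fam (vector_state \<xi>)"
    and "\<And>i. i \<in> I \<Longrightarrow> orth_proj (complex_vector.span {\<xi>}) \<in> A_fam i"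
    and "A_hat = subalgebra hull (\<Union>i\<in>I. A_fam i)"
    and "P_hat = orth_proj (closure ((\<lambda>X. X \<xi>) ` A_hat))"
  shows "semifinite_trace_on A_hat (\<lambda>X. pos_trace (P_hat \<circ> X \<circ> P_hat)) \<and>
    cyclic_boolean_independent I (\<lambda>i. A_fam i \<inter> trace_class) (vector_state \<xi>)
      (\<lambda>X. op_trace (P_hat \<circ> X \<circ> P_hat))"
proof -
  interpret F: boolean_independent_family \<xi> I A_fam
    using assms(2,4,5) by unfold_locales auto
  have "A_hat = F.B_hat" "P_hat = F.P_hat"
    by (simp_all add: assms(6,7) F.B_hat_def F.H_hat_def)
  then show ?thesis
    using F.semifinite_trace_on_B_hat F.cyclic_boolean_independent_trace_class by simp
qed

end
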